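(* Let $n\ge2$, let $\mathbb{D}=\{z\in\mathbb{C}:|z|<1\}$, and let $\mathbb{B}^n$ be the open unit ball of $\mathbb{R}^n$. For every harmonic map $f:\mathbb{D}\to\mathbb{B}^n$ we have $$\frac{1}{\sqrt2}\,|\nabla f(z)|\ \le\ \frac{\sqrt{1-|f(z)|^2}}{1-|z|^2},\qquad z\in\mathbb{D}.$$ Equality holds at a point $z\in\mathbb{D}$ if $f(z)$ is orthogonal to the 2-plane $\Lambda=df_z(\mathbb{R}^2)$ and $f$ is a conformal diffeomorphism of $\mathbb{D}$ onto the affine disc $(f(z)+\Lambda)\cap\mathbb{B}^n$. In particular, if $f(z)=0$ then $|\nabla f(z)|\le\frac{\sqrt2}{1-|z|^2}$, with equality if and only if $f$ is a conformal diffeomorphism of $\mathbb{D}$ onto the linear disc $\Lambda\cap\mathbb{B}^n$, where $\Lambda=df_z(\mathbb{R}^2)$.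
   Context: Write $z=x+iy$. A map $f=(f_1,\dots,f_n):\mathbb{D}\to\mathbb{R}^n$ is harmonic if every component $f_k$ is a harmonic function; no conformality is assumed. $|\nabla f(z)|^2=|f_x(z)|^2+|f_y(z)|^2$ with Euclidean norms of the partial derivatives. Conformal diffeomorphisms may preserve or reverse orientation. *)

theory Defs
  imports "HOL-Analysis.Analysis"
begin

text \<open>
  The derivatives below are taken with \<^term>\<open>at x\<close> (not within a set), so \<open>C_on\<close>
  is meant for open \<open>U\<close>.  There it says that \<open>f\<close> is of class \<open>C\<^sup>k\<close>: all partial derivatives
  up to order \<open>k\<close> exist and are continuous.
\<close>

primrec C_on :: "nat \<Rightarrow> ('a::euclidean_space \<Rightarrow> 'b::real_normed_vector) \<Rightarrow> 'a set \<Rightarrow> bool" where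
  "C_on 0 f U \<longleftrightarrow> continuous_on U f"
| "C_on (Suc k) f U \<longleftrightarrow>
     (\<forall>x\<in>U. f differentiable (at x)) \<and>
     (\<forall>b\<in>Basis. C_on k (\<lambda>x. frechet_derivative f (at x) b) U)"

text \<open>
  Smoothness on an arbitrary subset of a Euclidean space: locally the restriction of a
  \<open>C\<^sup>\<infinity>\<close> map defined on an open set of the ambient space.  This is needed for the inverse of a
  diffeomorphism onto a relatively open subset of an affine plane.
\<close>

definition smooth_on :: "('a::euclidean_space \<Rightarrow> 'b::real_normed_vector) \<Rightarrow> 'a set \<Rightarrow> bool" where
  "smooth_on f S \<longleftrightarrow>
     (\<forall>x\<in>S. \<exists>U F. open U \<and> x \<in> U \<and> (\<forall>k. C_on k F U) \<and> (\<forall>y\<in>S \<inter> U. F y = f y))"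

definition diffeomorphism_onto ::
    "('a::euclidean_space \<Rightarrow> 'b::euclidean_space) \<Rightarrow> 'a set \<Rightarrow> 'b set \<Rightarrow> bool" where
  "diffeomorphism_onto f S T \<longleftrightarrow>
     bij_betw f S T \<and> smooth_on f S \<and> smooth_on (inv_into S f) T"

text \<open>
  The pullback of the Euclidean metric is a positive multiple of the Euclidean metric at every
  point; nothing is said about orientation.  The domain \<open>S\<close> is meant to be open.
\<close>

definition conformal_on :: "('a::euclidean_space \<Rightarrow> 'b::euclidean_space) \<Rightarrow> 'a set \<Rightarrow> bool" where
  "conformal_on f S \<longleftrightarrow>
     (\<forall>x\<in>S. f differentiable (at x) \<and>
        (\<exists>c>0. \<forall>u v. frechet_derivative f (at x) u \<bullet> frechet_derivative f (at x) v = c * (u \<bullet> v)))"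

definition conformal_diffeomorphism_onto ::
    "('a::euclidean_space \<Rightarrow> 'b::euclidean_space) \<Rightarrow> 'a set \<Rightarrow> 'b set \<Rightarrow> bool" where
  "conformal_diffeomorphism_onto f S T \<longleftrightarrow> diffeomorphism_onto f S T \<and> conformal_on f S"

definition partial_x :: "(complex \<Rightarrow> 'b::real_normed_vector) \<Rightarrow> complex \<Rightarrow> 'b" where
  "partial_x f z = frechet_derivative f (at z) 1"

definition partial_y :: "(complex \<Rightarrow> 'b::real_normed_vector) \<Rightarrow> complex \<Rightarrow> 'b" where
  "partial_y f z = frechet_derivative f (at z) \<i>"

definition harmonic_on :: "(complex \<Rightarrow> real) \<Rightarrow> complex set \<Rightarrow> bool" where
  "harmonic_on u S \<longleftrightarrow> open S \<and> C_on 2 u S \<and>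
     (\<forall>z\<in>S. partial_x (partial_x u) z + partial_y (partial_y u) z = 0)"

definition harmonic_map_on :: "(complex \<Rightarrow> real ^ 'n) \<Rightarrow> complex set \<Rightarrow> bool" where
  "harmonic_map_on f S \<longleftrightarrow> (\<forall>k. harmonic_on (\<lambda>z. f z $ k) S)"

definition norm_grad :: "(complex \<Rightarrow> 'b::real_normed_vector) \<Rightarrow> complex \<Rightarrow> real" where
  "norm_grad f z = sqrt ((norm (partial_x f z))\<^sup>2 + (norm (partial_y f z))\<^sup>2)"

text \<open>The image \<open>df\<^sub>z(\<real>\<^sup>2)\<close> of the differential, as a linear subspace of the target.\<close>

definition tangent_image :: "(complex \<Rightarrow> 'b::real_normed_vector) \<Rightarrow> complex \<Rightarrow> 'b set" where
  "tangent_image f z = range (frechet_derivative f (at z))"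

end

theory Submission
  imports Defs "HOL-Complex_Analysis.Complex_Analysis"
begin

text \<open>
  Write \<open>f\<^sub>k = Re G\<^sub>k\<close> with \<open>G\<^sub>k\<close> holomorphic on the unit disc, let \<open>\<phi>\<close> be the Moebius automorphism of
  the disc that sends \<open>0\<close> to \<open>z\<close>, and put \<open>H\<^sub>k = G\<^sub>k \<circ> \<phi>\<close>, with Taylor coefficients \<open>c\<^sub>k\<^sub>j\<close> at \<open>0\<close>.
  The map \<open>f \<circ> \<phi>\<close> is again harmonic, it takes the value \<open>f(z)\<close> at \<open>0\<close>, and since
  \<open>\<phi>'(0) = 1 - |z|\<^sup>2\<close> the norm of its gradient at \<open>0\<close> is \<open>(1 - |z|\<^sup>2) |\<nabla>f(z)|\<close>.  The mean of
  \<open>|f \<circ> \<phi>|\<^sup>2\<close> over the circle of radius \<open>r\<close> is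
  \<open>|f(z)|\<^sup>2 + (1/2) (\<Sum>k. \<Sum>j\<ge>1. |c\<^sub>k\<^sub>j|\<^sup>2 r\<^bsup>2j\<^esup>)\<close>; it is at most \<open>1\<close> because \<open>f\<close> maps into the unit
  ball.  As \<open>r \<rightarrow> 1\<close>, the term \<open>j = 1\<close> alone gives
  \<open>|f(z)|\<^sup>2 + (1/2) ((1 - |z|\<^sup>2) |\<nabla>f(z)|)\<^sup>2 \<le> 1\<close>, which is the asserted inequality.  Bessel's
  inequality for finitely many \<open>j\<close> suffices (\<open>harmonic_bessel_inequality\<close>,
  \<open>harmonic_schwarz_pick\<close>).

  If equality holds, every \<open>c\<^sub>k\<^sub>j\<close> with \<open>j \<ge> 2\<close> vanishes, so \<open>f \<circ> \<phi>\<close> is affine.  When \<open>f(z) = 0\<close> it is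
  linear, it contracts the unit disc into the unit ball, and the squared lengths of the images of
  \<open>1\<close> and \<open>\<i>\<close> add up to \<open>2\<close>; such a map is a linear isometry.  Hence \<open>f\<close> is a linear isometry
  composed with \<open>\<phi>\<close> inverse, a conformal diffeomorphism onto the linear disc
  (\<open>extremal_harmonic_map_is_conformal_diffeomorphism\<close>).

  Conversely, let \<open>f\<close> be a conformal diffeomorphism onto the affine disc through \<open>f(z)\<close> spanned by
  \<open>\<Lambda> = df\<^sub>z(\<real>\<^sup>2)\<close>, with \<open>f(z)\<close> orthogonal to \<open>\<Lambda>\<close>.  Then \<open>f(z)\<close> is the centre of this disc and
  \<open>\<rho> = sqrt (1 - |f(z)|\<^sup>2)\<close> its radius, so \<open>f = f(z) + \<rho> E(h)\<close> for a linear isometry \<open>E\<close> of the plane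
  onto \<open>\<Lambda>\<close> and a bijection \<open>h\<close> of the unit disc with \<open>h(z) = 0\<close>.  The map \<open>h\<close> is harmonic and
  conformal, and \<open>E\<close> is chosen such that \<open>dh\<^sub>z\<close> is a positive multiple of the identity; this makes \<open>h\<close>
  holomorphic (\<open>conformal_harmonic_imp_holomorphic\<close>).  The Schwarz lemma for the inverse of \<open>h\<close>
  then bounds \<open>|h'(z)|\<close>, and with it \<open>|\<nabla>f(z)|\<close>, from below by the extremal value
  (\<open>conformal_diffeomorphism_onto_centred_disc_grad\<close>).
\<close>

section \<open>Harmonic functions as real parts of holomorphic functions\<close>

text \<open>
  The mean value theorem, once along \<open>a\<close> and once along \<open>b\<close>.  The second difference is symmetric in
  \<open>a\<close> and \<open>b\<close>, so two applications compare the two mixed second derivatives.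
\<close>
lemma second_difference_mean_value:
  fixes f :: "'a::real_normed_vector \<Rightarrow> real"
  assumes f': "\<And>x. x \<in> ball z d \<Longrightarrow> (f has_derivative f' x) (at x)"
    and f'': "\<And>x. x \<in> ball z d \<Longrightarrow> ((\<lambda>x. f' x a) has_derivative f'' x) (at x)"
    and h: "h > 0" "h * (norm a + norm b) < d"
  obtains p where "p \<in> ball z d"
    "f (z + h *\<^sub>R a + h *\<^sub>R b) - f (z + h *\<^sub>R a) - f (z + h *\<^sub>R b) + f z = h\<^sup>2 * f'' p b"
proof -
  have in_ball: "z + s *\<^sub>R a + t *\<^sub>R b \<in> ball z d" if "0 \<le> s" "s \<le> h" "0 \<le> t" "t \<le> h" for s t
  proof -
    have "norm (s *\<^sub>R a + t *\<^sub>R b) \<le> s * norm a + t * norm b"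
      using that norm_triangle_ineq[of "s *\<^sub>R a" "t *\<^sub>R b"] by simp
    also have "\<dots> \<le> h * norm a + h * norm b"
      using that by (intro add_mono mult_right_mono) auto
    also have "\<dots> < d" using h by (simp add: algebra_simps)
    finally have "norm (s *\<^sub>R a + t *\<^sub>R b) < d" .
    moreover have "z - (z + s *\<^sub>R a + t *\<^sub>R b) = - (s *\<^sub>R a + t *\<^sub>R b)" by simp
    ultimately show ?thesis by (simp only: mem_ball dist_norm norm_minus_cancel)
  qed
  define \<Phi> where "\<Phi> s = f (z + s *\<^sub>R a + h *\<^sub>R b) - f (z + s *\<^sub>R a + 0 *\<^sub>R b)" for s
  have d\<Phi>: "(\<Phi> has_real_derivative f' (z + s *\<^sub>R a + h *\<^sub>R b) a - f' (z + s *\<^sub>R a + 0 *\<^sub>R b) a) (at s)"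
    if "0 \<le> s" "s \<le> h" for s
  proof -
    have *: "((\<lambda>s. f (z + s *\<^sub>R a + t *\<^sub>R b)) has_real_derivative f' (z + s *\<^sub>R a + t *\<^sub>R b) a) (at s)"
      if "0 \<le> t" "t \<le> h" for t
    proof -
      have "(f has_derivative f' (z + s *\<^sub>R a + t *\<^sub>R b)) (at (z + s *\<^sub>R a + t *\<^sub>R b))"
        using in_ball that \<open>0 \<le> s\<close> \<open>s \<le> h\<close> by (intro f') auto
      moreover have "((\<lambda>s. z + s *\<^sub>R a + t *\<^sub>R b) has_derivative (\<lambda>v. v *\<^sub>R a)) (at s)"
        by (auto intro!: derivative_eq_intros)
      ultimately have "((\<lambda>s. f (z + s *\<^sub>R a + t *\<^sub>R b)) has_derivative (\<lambda>v. f' (z + s *\<^sub>R a + t *\<^sub>R b) (v *\<^sub>R a))) (at s)"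
        by (rule has_derivative_compose[rotated])
      moreover have "linear (f' (z + s *\<^sub>R a + t *\<^sub>R b))"
        using \<open>(f has_derivative f' (z + s *\<^sub>R a + t *\<^sub>R b)) _\<close> by (rule has_derivative_linear)
      ultimately show ?thesis
        by (simp add: has_field_derivative_def linear_scale mult_commute_abs)
    qed
    show ?thesis unfolding \<Phi>_def using h by (intro DERIV_diff *) auto
  qed
  obtain s where s: "0 < s" "s < h"
      "\<Phi> h - \<Phi> 0 = (h - 0) * (f' (z + s *\<^sub>R a + h *\<^sub>R b) a - f' (z + s *\<^sub>R a + 0 *\<^sub>R b) a)"
    using MVT2[OF h(1) d\<Phi>] by auto
  have d\<Psi>: "((\<lambda>t. f' (z + s *\<^sub>R a + t *\<^sub>R b) a) has_real_derivative f'' (z + s *\<^sub>R a + t *\<^sub>R b) b) (at t)"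
    if "0 \<le> t" "t \<le> h" for t
  proof -
    have *: "((\<lambda>x. f' x a) has_derivative f'' (z + s *\<^sub>R a + t *\<^sub>R b)) (at (z + s *\<^sub>R a + t *\<^sub>R b))"
      using in_ball that s by (intro f'') auto
    moreover have "((\<lambda>t. z + s *\<^sub>R a + t *\<^sub>R b) has_derivative (\<lambda>v. v *\<^sub>R b)) (at t)"
      by (auto intro!: derivative_eq_intros)
    ultimately have "((\<lambda>t. f' (z + s *\<^sub>R a + t *\<^sub>R b) a) has_derivative (\<lambda>v. f'' (z + s *\<^sub>R a + t *\<^sub>R b) (v *\<^sub>R b))) (at t)"
      by (rule has_derivative_compose[rotated])
    with has_derivative_linear[OF *] show ?thesis
      by (simp add: has_field_derivative_def linear_scale mult_commute_abs)
  qed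
  obtain t where t: "0 < t" "t < h"
      "f' (z + s *\<^sub>R a + h *\<^sub>R b) a - f' (z + s *\<^sub>R a + 0 *\<^sub>R b) a
        = (h - 0) * f'' (z + s *\<^sub>R a + t *\<^sub>R b) b"
    using MVT2[OF h(1) d\<Psi>] by auto
  show thesis
  proof
    show "z + s *\<^sub>R a + t *\<^sub>R b \<in> ball z d" using in_ball s t by auto
    show "f (z + h *\<^sub>R a + h *\<^sub>R b) - f (z + h *\<^sub>R a) - f (z + h *\<^sub>R b) + f z
        = h\<^sup>2 * f'' (z + s *\<^sub>R a + t *\<^sub>R b) b"
      using s(3) t(3) unfolding \<Phi>_def by (simp add: power2_eq_square)
  qed
qed

lemma has_derivative_frechet:
  "f differentiable (at x) \<Longrightarrow> (f has_derivative frechet_derivative f (at x)) (at x)"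
  using frechet_derivative_works by blast

lemma frechet_derivative_complex_expand:
  fixes u :: "complex \<Rightarrow> 'b::real_normed_vector"
  assumes "u differentiable (at z)"
  shows "frechet_derivative u (at z) v = Re v *\<^sub>R partial_x u z + Im v *\<^sub>R partial_y u z"
proof -
  have lin: "linear (frechet_derivative u (at z))"
    using assms by (rule linear_frechet_derivative)
  have "v = Re v *\<^sub>R 1 + Im v *\<^sub>R \<i>" by (simp add: complex_eq_iff)
  then have "frechet_derivative u (at z) v = frechet_derivative u (at z) (Re v *\<^sub>R 1 + Im v *\<^sub>R \<i>)" by simp
  also have "\<dots> = Re v *\<^sub>R partial_x u z + Im v *\<^sub>R partial_y u z"
    by (simp only: linear_add[OF lin] linear_scale[OF lin] partial_x_def partial_y_def)
  finally show ?thesis .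
qed

lemma C2_on_complexD:
  assumes "C_on 2 u S" and "z \<in> S"
  shows "u differentiable (at z)" "partial_x u differentiable (at z)" "partial_y u differentiable (at z)"
    "continuous_on S (partial_y (partial_x u))" "continuous_on S (partial_x (partial_y u))"
  using assms unfolding numeral_2_eq_2 partial_x_def[abs_def] partial_y_def[abs_def]
  by (auto simp: Basis_complex_def)

text \<open>
  The same second difference is \<open>h\<^sup>2\<close> times each mixed partial, at two points near \<open>z\<close>.  If the mixed
  partials differed at \<open>z\<close>, continuity would keep them apart at all nearby points.
\<close>
lemma mixed_partials_commute:
  fixes u :: "complex \<Rightarrow> real"
  assumes "open S" "C_on 2 u S" "z \<in> S"
  shows "partial_y (partial_x u) z = partial_x (partial_y u) z"
proof (rule ccontr)
  let ?p = "partial_y (partial_x u)" and ?q = "partial_x (partial_y u)"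
  assume ne: "?p z \<noteq> ?q z"
  define e where "e = \<bar>?p z - ?q z\<bar> / 2"
  have "e > 0" using ne by (simp add: e_def)
  obtain d0 where d0: "d0 > 0" "ball z d0 \<subseteq> S" using assms openE by blast
  have c: "isCont ?p z" "isCont ?q z"
    using C2_on_complexD(4,5)[OF assms(2,3)] assms continuous_on_eq_continuous_at by blast+
  obtain d1 where d1: "d1 > 0" "\<And>x. dist x z < d1 \<Longrightarrow> dist (?p x) (?p z) < e"
    using c(1) \<open>e > 0\<close> unfolding continuous_at_eps_delta by blast
  obtain d2 where d2: "d2 > 0" "\<And>x. dist x z < d2 \<Longrightarrow> dist (?q x) (?q z) < e"
    using c(2) \<open>e > 0\<close> unfolding continuous_at_eps_delta by blast
  define d where "d = min d0 (min d1 d2)"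
  have d: "d > 0" "ball z d \<subseteq> S" using d0 d1 d2 by (auto simp: d_def)
  \<comment> \<open>dividing by more than \<open>2\<close> keeps \<open>h (|1| + |\<i>|)\<close> strictly below \<open>d\<close>\<close>
  define h where "h = d / 3"
  have h: "h > 0" "h * (norm (1::complex) + norm \<i>) < d" "h * (norm \<i> + norm (1::complex)) < d"
    using d by (auto simp: h_def)
  have D: "(u has_derivative frechet_derivative u (at x)) (at x)"
    "((\<lambda>x. frechet_derivative u (at x) 1) has_derivative frechet_derivative (partial_x u) (at x)) (at x)"
    "((\<lambda>x. frechet_derivative u (at x) \<i>) has_derivative frechet_derivative (partial_y u) (at x)) (at x)"
    if "x \<in> ball z d" for x
    using C2_on_complexD[OF assms(2), of x] that d has_derivative_frechet
    unfolding partial_x_def[abs_def] partial_y_def[abs_def] by blast+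
  obtain p where p: "p \<in> ball z d"
      "u (z + h *\<^sub>R 1 + h *\<^sub>R \<i>) - u (z + h *\<^sub>R 1) - u (z + h *\<^sub>R \<i>) + u z = h\<^sup>2 * ?p p"
    using second_difference_mean_value[OF D(1,2) h(1,2)] unfolding partial_y_def by blast
  obtain q where q: "q \<in> ball z d"
      "u (z + h *\<^sub>R \<i> + h *\<^sub>R 1) - u (z + h *\<^sub>R \<i>) - u (z + h *\<^sub>R 1) + u z = h\<^sup>2 * ?q q"
    using second_difference_mean_value[OF D(1,3) h(1,3)] unfolding partial_x_def by blast
  have swap: "z + h *\<^sub>R \<i> + h *\<^sub>R 1 = z + h *\<^sub>R 1 + h *\<^sub>R \<i>" by simp
  have "h\<^sup>2 * ?p p = h\<^sup>2 * ?q q"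
    using p(2) q(2) unfolding swap by linarith
  then have "?p p = ?q q" using h by simp
  moreover have "dist (?p p) (?p z) < e" "dist (?q q) (?q z) < e"
    using p(1) q(1) d1(2)[of p] d2(2)[of q] by (auto simp: d_def dist_commute)
  ultimately show False unfolding e_def dist_real_def by argo
qed

text \<open>
  The function \<open>g = u\<^sub>x - \<i> u\<^sub>y\<close> satisfies the Cauchy-Riemann equations: one of them is Laplace's
  equation, the other is the symmetry of the second derivatives.  On a convex set \<open>g\<close> has a primitive
  \<open>G\<close>, and the differential of \<open>Re G\<close> is that of \<open>u\<close>, so \<open>u - Re G\<close> is constant.
\<close>
lemma harmonic_on_imp_Re_holomorphic:
  assumes u: "harmonic_on u S" and "convex S"
  obtains G where "G holomorphic_on S" "\<And>z. z \<in> S \<Longrightarrow> u z = Re (G z)"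
proof (cases "S = {}")
  case True
  show ?thesis by (rule that[of "\<lambda>_. 0"]) (auto simp: True)
next
  case False
  have S: "open S" "C_on 2 u S"
    and laplace: "\<And>z. z \<in> S \<Longrightarrow> partial_x (partial_x u) z + partial_y (partial_y u) z = 0"
    using u by (auto simp: harmonic_on_def)
  define g where "g z = Complex (partial_x u z) (- partial_y u z)" for z
  have "(g has_field_derivative
      Complex (partial_x (partial_x u) z) (- partial_y (partial_x u) z)) (at z)" if z: "z \<in> S" for z
  proof -
    note D = C2_on_complexD[OF S(2) z]
    have g_eq: "g = (\<lambda>z. of_real (partial_x u z) - \<i> * of_real (partial_y u z))"
      by (auto simp: g_def complex_eq_iff)
    have "(g has_derivative (\<lambda>v. of_real (frechet_derivative (partial_x u) (at z) v)
        - \<i> * of_real (frechet_derivative (partial_y u) (at z) v))) (at z)"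
      unfolding g_eq
      by (intro derivative_intros has_derivative_frechet D)
    moreover have "of_real (frechet_derivative (partial_x u) (at z) v)
        - \<i> * of_real (frechet_derivative (partial_y u) (at z) v)
      = Complex (partial_x (partial_x u) z) (- partial_y (partial_x u) z) * v" for v
      using laplace[OF z] mixed_partials_commute[OF S z]
      by (simp add: frechet_derivative_complex_expand D complex_eq_iff eq_neg_iff_add_eq_0[symmetric] algebra_simps)
    ultimately show ?thesis by (simp add: has_field_derivative_def)
  qed
  then have "g holomorphic_on S"
    using holomorphic_on_open S by blast
  from holomorphic_convex_primitive'[OF \<open>convex S\<close> S(1) this]
  obtain G where G: "\<And>z. z \<in> S \<Longrightarrow> (G has_field_derivative g z) (at z within S)" by blast
  have "((\<lambda>z. u z - Re (G z)) has_derivative (\<lambda>v. 0)) (at z within S)" if z: "z \<in> S" for z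
  proof -
    have "(u has_derivative frechet_derivative u (at z)) (at z within S)"
      using C2_on_complexD(1)[OF S(2) z] has_derivative_frechet has_derivative_at_withinI by blast
    moreover have "(G has_derivative (*) (g z)) (at z within S)"
      using G[OF z] by (simp add: has_field_derivative_def)
    ultimately have "((\<lambda>z. u z - Re (G z)) has_derivative
        (\<lambda>v. frechet_derivative u (at z) v - Re (g z * v))) (at z within S)"
      by (intro derivative_intros)
    moreover have "frechet_derivative u (at z) v - Re (g z * v) = 0" for v
      using C2_on_complexD(1)[OF S(2) z] by (simp add: frechet_derivative_complex_expand g_def)
    ultimately show ?thesis by simp
  qed
  from has_derivative_zero_constant[OF \<open>convex S\<close> this]
  obtain c where c: "\<And>z. z \<in> S \<Longrightarrow> u z - Re (G z) = c" by blast
  show ?thesis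
  proof
    have "G holomorphic_on S"
      using G unfolding holomorphic_on_def field_differentiable_def by blast
    then show "(\<lambda>z. G z + of_real c) holomorphic_on S" by (intro holomorphic_intros)
    show "u z = Re (G z + of_real c)" if "z \<in> S" for z using c[OF that] by simp
  qed
qed

lemma has_derivative_imp_frechet:
  "(f has_derivative f') (at x) \<Longrightarrow> frechet_derivative f (at x) = f'"
  using frechet_derivative_at by metis

lemma harmonic_map_on_imp_Re_holomorphic:
  fixes f :: "complex \<Rightarrow> real ^ 'n"
  assumes "harmonic_map_on f S" and "convex S"
  obtains G where "\<And>k. G k holomorphic_on S" "\<And>z k. z \<in> S \<Longrightarrow> f z $ k = Re (G k z)"
proof -
  have "\<exists>G. G holomorphic_on S \<and> (\<forall>z\<in>S. f z $ k = Re (G z))" for k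
    using assms harmonic_on_imp_Re_holomorphic[of "\<lambda>z. f z $ k" S]
    unfolding harmonic_map_on_def by metis
  then have "\<exists>G. \<forall>k. G k holomorphic_on S \<and> (\<forall>z\<in>S. f z $ k = Re (G k z))" by metis
  with that show ?thesis by blast
qed

lemma has_derivative_Re_holomorphic_components:
  fixes f :: "complex \<Rightarrow> real ^ 'n"
  assumes "open S" "\<And>k. G k holomorphic_on S" "\<And>z k. z \<in> S \<Longrightarrow> f z $ k = Re (G k z)" "z \<in> S"
  shows "(f has_derivative (\<lambda>v. \<chi> k. Re (deriv (G k) z * v))) (at z)"
proof -
  have "((\<lambda>z. \<chi> k. Re (G k z)) has_derivative (\<lambda>v. \<chi> k. Re (deriv (G k) z * v))) (at z)"
  proof -
    have "((\<lambda>z. Re (G k z)) has_derivative (\<lambda>v. Re (deriv (G k) z * v))) (at z)" for k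
    proof (intro has_derivative_Re)
      have "(G k has_field_derivative deriv (G k) z) (at z)"
        using assms holomorphic_derivI by blast
      then show "(G k has_derivative (*) (deriv (G k) z)) (at z)" by (simp add: has_field_derivative_def)
    qed
    then show ?thesis
      by (subst has_derivative_componentwise_within) (auto simp: Basis_vec_def inner_axis)
  qed
  then show ?thesis
    by (rule has_derivative_transform_within_open[OF _ assms(1,4)]) (simp add: assms(3) vec_eq_iff)
qed

section \<open>A Bessel inequality for harmonic maps into the unit ball\<close>

abbreviation taylor_coeff :: "(complex \<Rightarrow> complex) \<Rightarrow> nat \<Rightarrow> complex" where
  "taylor_coeff H j \<equiv> (deriv ^^ j) H 0 / fact j"

text \<open>
  Cauchy's formula for the \<open>j\<close>-th derivative, rewritten as a mean over the circle: on it the conjugate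
  of \<open>\<gamma>\<^sup>j\<close> is \<open>r\<^bsup>2j\<^esup> / \<gamma>\<^sup>j\<close>, and \<open>d\<gamma> = 2 \<pi> \<i> \<gamma> dt\<close>.
\<close>
lemma circle_mean_taylor_coeff:
  assumes H: "H holomorphic_on ball 0 R" and r: "0 < r" "r < R"
  shows "((\<lambda>t. H (circlepath 0 r t) * cnj (circlepath 0 r t ^ j)) has_integral
    taylor_coeff H j * of_real (r ^ (2 * j))) {0..1}"
proof -
  have "continuous_on (cball 0 r) H" "H holomorphic_on ball 0 r"
    using H r by (auto intro!: holomorphic_on_imp_continuous_on elim: holomorphic_on_subset)
  from Cauchy_has_contour_integral_higher_derivative_circlepath[OF this, of 0 j]
  have "((\<lambda>t. H (circlepath 0 r t) / (circlepath 0 r t) ^ Suc j *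
      (2 * pi * \<i> * r * exp (2 * of_real pi * \<i> * t))) has_integral
      2 * pi * \<i> / fact j * (deriv ^^ j) H 0) {0..1}"
    using r by (simp add: has_contour_integral vector_derivative_circlepath)
  \<comment> \<open>the factor turns \<open>d\<gamma> / \<gamma>\<^bsup>j+1\<^esup>\<close> into the conjugate of \<open>\<gamma>\<^sup>j\<close> times \<open>dt\<close>\<close>
  from has_integral_mult_right[OF this, of "of_real (r ^ (2 * j)) / (2 * pi * \<i>)"]
  have "((\<lambda>t. of_real (r ^ (2 * j)) / (2 * pi * \<i>) * (H (circlepath 0 r t) / (circlepath 0 r t) ^ Suc j *
      (2 * pi * \<i> * r * exp (2 * of_real pi * \<i> * t)))) has_integral
      taylor_coeff H j * of_real (r ^ (2 * j))) {0..1}"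
    by (simp add: field_simps)
  moreover have "of_real (r ^ (2 * j)) / (2 * pi * \<i>) * (H (circlepath 0 r t) / (circlepath 0 r t) ^ Suc j *
      (2 * pi * \<i> * r * exp (2 * of_real pi * \<i> * t))) = H (circlepath 0 r t) * cnj (circlepath 0 r t ^ j)" for t
  proof -
    define \<gamma> where "\<gamma> = circlepath 0 r t"
    have \<gamma>: "\<gamma> = r * exp (2 * of_real pi * \<i> * t)" by (simp add: \<gamma>_def circlepath)
    then have ne: "\<gamma> \<noteq> 0" using r by simp
    have sq: "of_real (r\<^sup>2) = \<gamma> * cnj \<gamma>"
      unfolding complex_norm_square[symmetric] using r by (simp add: \<gamma> norm_mult)
    have "complex_of_real (r ^ (2 * j)) = (of_real (r\<^sup>2)) ^ j" by (simp add: power_mult)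
    also have "\<dots> = \<gamma> ^ j * cnj \<gamma> ^ j" unfolding sq by (rule power_mult_distrib)
    finally have "of_real (r ^ (2 * j)) = \<gamma> ^ j * cnj \<gamma> ^ j" .
    moreover have "2 * pi * \<i> * r * exp (2 * of_real pi * \<i> * t) = 2 * pi * \<i> * \<gamma>"
      by (simp add: \<gamma>)
    moreover have "\<gamma> ^ j * cnj \<gamma> ^ j / (2 * pi * \<i>) * (H \<gamma> / \<gamma> ^ Suc j * (2 * pi * \<i> * \<gamma>))
        = H \<gamma> * cnj (\<gamma> ^ j)"
      using ne by (simp add: field_simps)
    ultimately show ?thesis
      unfolding \<gamma>_def[symmetric] by (simp only:)
  qed
  ultimately show ?thesis by simp
qed

lemma taylor_coeff_power: "taylor_coeff (\<lambda>w. w ^ i) j = (if i = j then 1 else 0)"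
  using higher_deriv_power[of j 0 i 0]
  by (auto simp: not_less pochhammer_0_left pochhammer_fact[symmetric] Suc_diff_le)

lemma taylor_coeff_polynomial:
  assumes "finite J"
  shows "taylor_coeff (\<lambda>w. \<Sum>i\<in>J. p i * w ^ i) j = (if j \<in> J then p j else 0)"
proof -
  have "(deriv ^^ j) (\<lambda>w. \<Sum>i\<in>J. p i * w ^ i) 0 = (\<Sum>i\<in>J. p i * (deriv ^^ j) (\<lambda>w. w ^ i) 0)"
    using assms
  proof (induction J rule: finite_induct)
    case (insert i J)
    have "(deriv ^^ j) (\<lambda>w. p i * w ^ i + (\<Sum>i\<in>J. p i * w ^ i)) 0
        = (deriv ^^ j) (\<lambda>w. p i * w ^ i) 0 + (deriv ^^ j) (\<lambda>w. \<Sum>i\<in>J. p i * w ^ i) 0"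
      by (intro higher_deriv_add[where S=UNIV]) (auto intro!: holomorphic_intros)
    also have "(deriv ^^ j) (\<lambda>w. p i * w ^ i) 0 = p i * (deriv ^^ j) (\<lambda>w. w ^ i) 0"
      by (intro higher_deriv_cmult[where A=UNIV]) (auto intro!: holomorphic_intros)
    finally show ?case using insert by simp
  qed simp
  then have "taylor_coeff (\<lambda>w. \<Sum>i\<in>J. p i * w ^ i) j = (\<Sum>i\<in>J. p i * taylor_coeff (\<lambda>w. w ^ i) j)"
    by (simp add: sum_divide_distrib)
  also have "\<dots> = (if j \<in> J then p j else 0)"
    using assms by (simp add: taylor_coeff_power if_distrib sum.delta cong: if_cong)
  finally show ?thesis .
qed

text \<open>
  This rests on \<open>Re a * Re b = Re (a b + a (cnj b)) / 2\<close>.  The mean of \<open>H P\<close> is its value at the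
  centre, and the mean of \<open>H (cnj P)\<close> picks out Taylor coefficients.
\<close>
lemma circle_mean_Re_times_Re_polynomial:
  fixes p :: "nat \<Rightarrow> complex"
  assumes H: "H holomorphic_on ball 0 R" and r: "0 < r" "r < R" and J: "finite J"
  defines "P \<equiv> \<lambda>w. \<Sum>j\<in>J. p j * w ^ j"
  shows "((\<lambda>t. Re (H (circlepath 0 r t)) * Re (P (circlepath 0 r t))) has_integral
    Re (H 0 * P 0 + (\<Sum>j\<in>J. taylor_coeff H j * cnj (p j) * of_real (r ^ (2 * j)))) / 2) {0..1}"
proof -
  let ?\<gamma> = "circlepath 0 r"
  have "(\<lambda>w. H w * P w) holomorphic_on ball 0 R"
    unfolding P_def by (intro holomorphic_intros H)
  from circle_mean_taylor_coeff[OF this r, of 0]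
  have 1: "((\<lambda>t. H (?\<gamma> t) * P (?\<gamma> t)) has_integral H 0 * P 0) {0..1}" by simp
  have "((\<lambda>t. \<Sum>j\<in>J. cnj (p j) * (H (?\<gamma> t) * cnj (?\<gamma> t ^ j))) has_integral
      (\<Sum>j\<in>J. cnj (p j) * (taylor_coeff H j * of_real (r ^ (2 * j))))) {0..1}"
    using J by (intro has_integral_sum has_integral_mult_right circle_mean_taylor_coeff[OF H r])
  then have 2: "((\<lambda>t. H (?\<gamma> t) * cnj (P (?\<gamma> t))) has_integral
      (\<Sum>j\<in>J. taylor_coeff H j * cnj (p j) * of_real (r ^ (2 * j)))) {0..1}"
    by (simp add: P_def sum_distrib_left mult_ac)
  have "((\<lambda>t. Re (H (?\<gamma> t) * P (?\<gamma> t) + H (?\<gamma> t) * cnj (P (?\<gamma> t))) / 2) has_integral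
      Re (H 0 * P 0 + (\<Sum>j\<in>J. taylor_coeff H j * cnj (p j) * of_real (r ^ (2 * j)))) / 2) {0..1}"
    using has_integral_linear[OF has_integral_add[OF 1 2] bounded_linear_Re]
    by (intro has_integral_divide) (simp add: o_def)
  then show ?thesis by (simp add: algebra_simps)
qed

text \<open>
  Let \<open>P\<^sub>k\<close> be the part of the Taylor series of \<open>H\<^sub>k\<close> with exponents in \<open>insert 0 J\<close>, and put
  \<open>u\<^sub>k = Re H\<^sub>k\<close>, \<open>p\<^sub>k = Re P\<^sub>k\<close>.  The means of \<open>u\<^sub>k p\<^sub>k\<close> and of \<open>p\<^sub>k\<^sup>2\<close> are equal, both being the \<open>k\<close>-th
  summand below, and pointwise \<open>2 u\<^sub>k p\<^sub>k - p\<^sub>k\<^sup>2 \<le> u\<^sub>k\<^sup>2\<close>.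
\<close>
lemma harmonic_bessel_inequality_on_circle:
  fixes H :: "'k::finite \<Rightarrow> complex \<Rightarrow> complex"
  assumes H: "\<And>k. H k holomorphic_on ball 0 1"
    and bound: "\<And>w. w \<in> ball 0 1 \<Longrightarrow> (\<Sum>k\<in>UNIV. (Re (H k w))\<^sup>2) \<le> 1"
    and J: "finite J" "0 \<notin> J" and r: "0 < r" "r < 1"
  shows "(\<Sum>k\<in>UNIV. (Re (H k 0))\<^sup>2 +
      (\<Sum>j\<in>J. (cmod (taylor_coeff (H k) j))\<^sup>2 * r ^ (2 * j)) / 2) \<le> 1"
proof -
  define c where "c k j = taylor_coeff (H k) j" for k j
  define P where "P k w = (\<Sum>j\<in>insert 0 J. c k j * w ^ j)" for k w
  define I where "I k = (Re (H k 0))\<^sup>2 + (\<Sum>j\<in>J. (cmod (c k j))\<^sup>2 * r ^ (2 * j)) / 2" for k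
  let ?\<gamma> = "circlepath 0 r"
  have J0: "finite (insert 0 J)" using J by simp
  have P0: "P k 0 = H k 0" for k
    using J by (simp add: P_def c_def power_0_left if_distrib sum.delta cong: if_cong)
  have I: "Re (H k 0 * P k 0 + (\<Sum>j\<in>insert 0 J. c k j * cnj (c k j) * of_real (r ^ (2 * j)))) / 2 = I k" for k
  proof -
    have "c k j * cnj (c k j) * of_real (r ^ (2 * j)) = of_real ((cmod (c k j))\<^sup>2 * r ^ (2 * j))" for j
      by (simp only: of_real_mult complex_norm_square)
    then have "(\<Sum>j\<in>insert 0 J. c k j * cnj (c k j) * of_real (r ^ (2 * j))) =
        of_real ((cmod (c k 0))\<^sup>2 + (\<Sum>j\<in>J. (cmod (c k j))\<^sup>2 * r ^ (2 * j)))"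
      using J by (simp only: of_real_sum[symmetric] sum.insert) simp
    moreover have "(cmod (c k 0))\<^sup>2 = (Re (H k 0))\<^sup>2 + (Im (H k 0))\<^sup>2"
      by (simp add: c_def cmod_power2)
    ultimately show ?thesis by (simp add: P0 I_def field_simps power2_eq_square)
  qed
  have HP: "((\<lambda>t. Re (H k (?\<gamma> t)) * Re (P k (?\<gamma> t))) has_integral I k) {0..1}" for k
    using circle_mean_Re_times_Re_polynomial[OF H[of k] r J0, of "c k"] I[of k]
    by (simp add: P_def c_def)
  have hol: "P k holomorphic_on ball 0 1" for k
    unfolding P_def[abs_def] by (intro holomorphic_intros)
  have coeff: "taylor_coeff (P k) j = c k j" if "j \<in> insert 0 J" for k j
    unfolding P_def[abs_def] taylor_coeff_polynomial[OF J0] using that by simp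
  have PP: "((\<lambda>t. Re (P k (?\<gamma> t)) * Re (P k (?\<gamma> t))) has_integral I k) {0..1}" for k
  proof -
    have "(\<Sum>j\<in>insert 0 J. taylor_coeff (P k) j * cnj (c k j) * of_real (r ^ (2 * j)))
        = (\<Sum>j\<in>insert 0 J. c k j * cnj (c k j) * of_real (r ^ (2 * j)))"
      by (intro sum.cong refl) (simp only: coeff)
    then show ?thesis
      using circle_mean_Re_times_Re_polynomial[OF hol[of k] r J0, of "c k"] I[of k]
      unfolding P_def[symmetric] by (simp only: P0)
  qed
  have mean: "((\<lambda>t. \<Sum>k\<in>UNIV. 2 * (Re (H k (?\<gamma> t)) * Re (P k (?\<gamma> t)))
      - Re (P k (?\<gamma> t)) * Re (P k (?\<gamma> t))) has_integral (\<Sum>k\<in>UNIV. 2 * I k - I k)) {0..1}"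
    by (intro has_integral_sum has_integral_diff has_integral_mult_right HP PP) auto
  have one: "((\<lambda>t. 1) has_integral (1::real)) {0..1::real}"
    using has_integral_const_real[of "1::real" 0 1] by simp
  have "(\<Sum>k\<in>UNIV. 2 * (Re (H k (?\<gamma> t)) * Re (P k (?\<gamma> t)))
      - Re (P k (?\<gamma> t)) * Re (P k (?\<gamma> t))) \<le> 1" for t
  proof -
    have "2 * (a * b) - b * b \<le> a\<^sup>2" for a b :: real
      using zero_le_power2[of "a - b"] by (simp add: power2_eq_square algebra_simps)
    then have "(\<Sum>k\<in>UNIV. 2 * (Re (H k (?\<gamma> t)) * Re (P k (?\<gamma> t)))
      - Re (P k (?\<gamma> t)) * Re (P k (?\<gamma> t))) \<le> (\<Sum>k\<in>UNIV. (Re (H k (?\<gamma> t)))\<^sup>2)"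
      by (intro sum_mono)
    also have "\<dots> \<le> 1" using r by (intro bound) (simp add: circlepath norm_mult)
    finally show ?thesis .
  qed
  then have "(\<Sum>k\<in>UNIV. 2 * I k - I k) \<le> 1"
    by (rule has_integral_le[OF mean one])
  then show ?thesis by (simp add: I_def c_def)
qed

lemma harmonic_bessel_inequality:
  fixes H :: "'k::finite \<Rightarrow> complex \<Rightarrow> complex"
  assumes H: "\<And>k. H k holomorphic_on ball 0 1"
    and bound: "\<And>w. w \<in> ball 0 1 \<Longrightarrow> (\<Sum>k\<in>UNIV. (Re (H k w))\<^sup>2) \<le> 1"
    and J: "finite J" "0 \<notin> J"
  shows "(\<Sum>k\<in>UNIV. (Re (H k 0))\<^sup>2 + (\<Sum>j\<in>J. (cmod (taylor_coeff (H k) j))\<^sup>2) / 2) \<le> 1"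
proof (rule tendsto_upperbound)
  let ?E = "\<lambda>r. \<Sum>k\<in>UNIV. (Re (H k 0))\<^sup>2 + (\<Sum>j\<in>J. (cmod (taylor_coeff (H k) j))\<^sup>2 * r ^ (2 * j)) / 2"
  have "(?E \<longlongrightarrow> ?E 1) (at_left 1)" by (intro tendsto_intros) auto
  then show "(?E \<longlongrightarrow> (\<Sum>k\<in>UNIV. (Re (H k 0))\<^sup>2 + (\<Sum>j\<in>J. (cmod (taylor_coeff (H k) j))\<^sup>2) / 2)) (at_left 1)"
    by simp
  show "\<forall>\<^sub>F r in at_left 1. ?E r \<le> 1"
    by (rule eventually_mono[OF eventually_at_left_real[of 0 1]])
      (auto intro!: harmonic_bessel_inequality_on_circle[OF H bound J])
qed simp

lemma holomorphic_affine_if_higher_taylor_coeffs_zero: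
  assumes H: "H holomorphic_on ball 0 R" and zero: "\<And>j. j \<ge> 2 \<Longrightarrow> taylor_coeff H j = 0"
    and w: "w \<in> ball 0 R"
  shows "H w = H 0 + deriv H 0 * w"
proof -
  have "(\<lambda>n. taylor_coeff H n * w ^ n) sums H w"
    using holomorphic_power_series[OF H w] by simp
  moreover have "(\<lambda>n. taylor_coeff H n * w ^ n) sums (\<Sum>n\<in>{0,1}. taylor_coeff H n * w ^ n)"
    using zero by (intro sums_finite) (auto simp: numeral_2_eq_2 not_less_eq_eq)
  ultimately show ?thesis using sums_unique2 by fastforce
qed

section \<open>The inequality, by transport to the centre of the disc\<close>

lemma power2_norm_vec: "(norm (x :: real ^ 'n))\<^sup>2 = (\<Sum>k\<in>UNIV. (x $ k)\<^sup>2)"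
  unfolding power2_norm_eq_inner inner_vec_def by (simp add: power2_eq_square)

lemma power2_norm_grad:
  "(norm_grad f z)\<^sup>2 = (norm (frechet_derivative f (at z) 1))\<^sup>2 + (norm (frechet_derivative f (at z) \<i>))\<^sup>2"
  by (simp add: norm_grad_def partial_x_def partial_y_def)

lemma has_field_derivative_Moebius_function:
  assumes "1 - cnj a * w \<noteq> 0"
  shows "(Moebius_function 0 a has_field_derivative (1 - of_real ((cmod a)\<^sup>2)) / (1 - cnj a * w)\<^sup>2) (at w)"
proof -
  have "((\<lambda>w. (w - a) / (1 - cnj a * w)) has_field_derivative
     (1 * (1 - cnj a * w) - (w - a) * (- cnj a)) / ((1 - cnj a * w) * (1 - cnj a * w))) (at w)"
    using assms by (auto intro!: derivative_eq_intros)
  moreover have "1 * (1 - cnj a * w) - (w - a) * (- cnj a) = 1 - of_real ((cmod a)\<^sup>2)"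
    by (simp only: complex_norm_square) (simp add: algebra_simps)
  ultimately show ?thesis
    unfolding Moebius_function_simple[abs_def] power2_eq_square[of "1 - cnj a * w"] by (simp only:)
qed

lemma one_minus_power2_cmod_pos: "cmod z < 1 \<Longrightarrow> 0 < 1 - (cmod z)\<^sup>2"
  by (simp add: power_less_one_iff abs_square_less_1)

lemma deriv_Moebius_function:
  assumes "cmod z < 1"
  shows "deriv (Moebius_function 0 (- z)) 0 = of_real (1 - (cmod z)\<^sup>2)"
    and "deriv (Moebius_function 0 z) z = of_real (1 / (1 - (cmod z)\<^sup>2))"
proof -
  show "deriv (Moebius_function 0 (- z)) 0 = of_real (1 - (cmod z)\<^sup>2)"
    using DERIV_imp_deriv[OF has_field_derivative_Moebius_function[of "- z" 0]] by simp
  have eq: "1 - cnj z * z = of_real (1 - (cmod z)\<^sup>2)"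
    by (simp only: of_real_diff of_real_1 complex_norm_square mult.commute)
  have ne: "1 - cnj z * z \<noteq> 0"
    unfolding eq of_real_eq_0_iff using one_minus_power2_cmod_pos[OF assms] by simp
  show "deriv (Moebius_function 0 z) z = of_real (1 / (1 - (cmod z)\<^sup>2))"
    using DERIV_imp_deriv[OF has_field_derivative_Moebius_function[OF ne]] ne
    unfolding eq by (simp add: power2_eq_square[of "1 - _"])
qed

text \<open>
  Bessel's inequality for the components of \<open>f \<circ> \<phi>\<close>, where the Moebius map \<open>\<phi>\<close> moves \<open>0\<close> to \<open>z\<close>: with
  \<open>J = {1}\<close> it is the inequality.  In the case of equality \<open>J = {1, j}\<close> shows that each coefficient
  of order \<open>j \<ge> 2\<close> vanishes, so \<open>f \<circ> \<phi>\<close> is its own first-order Taylor polynomial.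
\<close>
lemma harmonic_schwarz_pick:
  fixes f :: "complex \<Rightarrow> real ^ 'n"
  assumes f: "harmonic_map_on f (ball 0 1)" "f ` ball 0 1 \<subseteq> ball 0 1" and z: "z \<in> ball 0 1"
  shows "(norm (f z))\<^sup>2 + ((1 - (cmod z)\<^sup>2) * norm_grad f z)\<^sup>2 / 2 \<le> 1"
    and "\<lbrakk>(norm (f z))\<^sup>2 + ((1 - (cmod z)\<^sup>2) * norm_grad f z)\<^sup>2 / 2 = 1; w \<in> ball 0 1\<rbrakk> \<Longrightarrow>
      f (Moebius_function 0 (- z) w) = f z + (1 - (cmod z)\<^sup>2) *\<^sub>R frechet_derivative f (at z) w"
proof -
  obtain G where G: "\<And>k. G k holomorphic_on ball 0 1" "\<And>z k. z \<in> ball 0 1 \<Longrightarrow> f z $ k = Re (G k z)"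
    using harmonic_map_on_imp_Re_holomorphic[OF f(1) convex_ball] by blast
  define \<phi> where "\<phi> = Moebius_function 0 (- z)"
  define s where "s = 1 - (cmod z)\<^sup>2"
  have \<phi>: "\<phi> holomorphic_on ball 0 1" "\<phi> ` ball 0 1 \<subseteq> ball 0 1" "\<phi> 0 = z" "deriv \<phi> 0 = of_real s"
    using z Moebius_function_holomorphic[of "- z" 0] Moebius_function_norm_lt_1[of "- z"]
      deriv_Moebius_function(1)[of z]
    by (auto simp: \<phi>_def s_def Moebius_function_of_zero)
  define H where "H k = G k \<circ> \<phi>" for k
  have H: "H k holomorphic_on ball 0 1" for k
    unfolding H_def by (rule holomorphic_on_compose_gen[OF \<phi>(1) G(1) \<phi>(2)])
  have fH: "f (\<phi> w) $ k = Re (H k w)" if "w \<in> ball 0 1" for w k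
    using that \<phi>(2) by (auto simp: H_def intro!: G(2))
  have bound: "(\<Sum>k\<in>UNIV. (Re (H k w))\<^sup>2) \<le> 1" if "w \<in> ball 0 1" for w
  proof -
    have "(\<Sum>k\<in>UNIV. (Re (H k w))\<^sup>2) = (norm (f (\<phi> w)))\<^sup>2"
      using that by (simp add: power2_norm_vec fH)
    moreover have "norm (f (\<phi> w)) < 1" using that \<phi>(2) f(2) by (simp add: image_subset_iff)
    ultimately show ?thesis by (simp add: power_le_one)
  qed
  have dH: "deriv (H k) 0 = of_real s * deriv (G k) z" for k
  proof -
    have "\<phi> field_differentiable at 0" "G k field_differentiable at (\<phi> 0)"
      unfolding \<phi>(3) using \<phi>(1) holomorphic_on_imp_differentiable_at[OF G(1) open_ball z]
      by (auto intro: holomorphic_on_imp_differentiable_at)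
    then show ?thesis unfolding H_def by (simp add: deriv_chain \<phi>)
  qed
  have df: "frechet_derivative f (at z) = (\<lambda>v. \<chi> k. Re (deriv (G k) z * v))"
    by (rule has_derivative_imp_frechet[OF has_derivative_Re_holomorphic_components[OF open_ball G z]])
  have "(norm_grad f z)\<^sup>2 = (\<Sum>k\<in>UNIV. (cmod (deriv (G k) z))\<^sup>2)"
    unfolding power2_norm_grad df power2_norm_vec
    by (simp add: cmod_power2 sum.distrib)
  then have grad: "(s * norm_grad f z)\<^sup>2 = (\<Sum>k\<in>UNIV. (cmod (taylor_coeff (H k) 1))\<^sup>2)"
    by (simp add: dH norm_mult power_mult_distrib sum_distrib_left)
  have fz: "(norm (f z))\<^sup>2 = (\<Sum>k\<in>UNIV. (Re (H k 0))\<^sup>2)"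
    using fH[of 0] by (simp add: power2_norm_vec \<phi>)
  show "(norm (f z))\<^sup>2 + ((1 - (cmod z)\<^sup>2) * norm_grad f z)\<^sup>2 / 2 \<le> 1"
    using harmonic_bessel_inequality[OF H bound, of "{1}"]
    unfolding s_def[symmetric] grad fz by (simp add: sum.distrib sum_divide_distrib)
  assume eq: "(norm (f z))\<^sup>2 + ((1 - (cmod z)\<^sup>2) * norm_grad f z)\<^sup>2 / 2 = 1" and w: "w \<in> ball 0 1"
  have zero: "taylor_coeff (H k) j = 0" if "j \<ge> 2" for k j
  proof -
    have "(\<Sum>k\<in>UNIV. (cmod (taylor_coeff (H k) j))\<^sup>2) \<le> 0"
      using harmonic_bessel_inequality[OF H bound, of "{1, j}"] that eq
      unfolding s_def[symmetric] grad fz by (simp add: sum.distrib add_divide_distrib flip: sum_divide_distrib)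
    then have "(\<Sum>k\<in>UNIV. (cmod (taylor_coeff (H k) j))\<^sup>2) = 0"
      by (intro antisym sum_nonneg) auto
    then show ?thesis by (simp add: sum_nonneg_eq_0_iff)
  qed
  show "f (Moebius_function 0 (- z) w) = f z + (1 - (cmod z)\<^sup>2) *\<^sub>R frechet_derivative f (at z) w"
    unfolding \<phi>_def[symmetric] s_def[symmetric]
  proof (subst vec_eq_iff, intro allI)
    fix k
    have "f (\<phi> w) $ k = Re (H k 0 + deriv (H k) 0 * w)"
      using fH[OF w, of k] holomorphic_affine_if_higher_taylor_coeffs_zero[OF H zero w] by simp
    also have "\<dots> = (f z + s *\<^sub>R frechet_derivative f (at z) w) $ k"
      using fH[of 0 k] by (simp add: df dH \<phi> mult.assoc)
    finally show "f (\<phi> w) $ k = (f z + s *\<^sub>R frechet_derivative f (at z) w) $ k" .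
  qed
qed

section \<open>Smoothness and linear isometries\<close>

lemma C_on_cong:
  assumes "open U" "\<And>x. x \<in> U \<Longrightarrow> f x = g x" "C_on k f U"
  shows "C_on k g U"
  using assms(2,3)
proof (induction k arbitrary: f g)
  case 0
  then show ?case using continuous_on_cong by fastforce
next
  case (Suc k)
  have diff: "f differentiable (at x)" if "x \<in> U" for x using Suc.prems that by simp
  have eq: "frechet_derivative f (at x) = frechet_derivative g (at x)" if "x \<in> U" for x
    using frechet_derivative_transform_within_open[OF diff \<open>open U\<close>] that Suc.prems(1) by blast
  have "g differentiable (at x)" if "x \<in> U" for x
    using diff[OF that] has_derivative_transform_within_open[OF _ \<open>open U\<close> that] Suc.prems(1)
    unfolding differentiable_def by blast
  moreover have "C_on k (\<lambda>x. frechet_derivative g (at x) b) U" if "b \<in> Basis" for b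
    by (rule Suc.IH[of "\<lambda>x. frechet_derivative f (at x) b"]) (use Suc.prems eq that in auto)
  ultimately show ?case by simp
qed

lemma has_derivative_linear_holomorphic_linear:
  assumes "bounded_linear L" "bounded_linear M" "h holomorphic_on V" "open V" "M x \<in> V"
  shows "((\<lambda>x. L (h (M x))) has_derivative (\<lambda>v. L (deriv h (M x) * M v))) (at x)"
proof -
  have "(M has_derivative M) (at x)"
    using assms(2) by (rule bounded_linear_imp_has_derivative)
  moreover have "(h has_derivative (*) (deriv h (M x))) (at (M x))"
    using holomorphic_derivI[OF assms(3-5)] by (simp add: has_field_derivative_def)
  ultimately have "((\<lambda>x. h (M x)) has_derivative (\<lambda>v. deriv h (M x) * M v)) (at x)"
    by (rule has_derivative_compose)
  then show ?thesis by (rule bounded_linear.has_derivative[OF assms(1)])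
qed

text \<open>
  Induction works because the class of maps \<open>L \<circ> h \<circ> M\<close> is closed under directional derivatives: the
  derivative in direction \<open>b\<close> has the same form, with \<open>h\<close> replaced by its derivative and
  multiplication by \<open>M b\<close> absorbed into \<open>L\<close>.  Harmonic maps that vanish
  at a point of equality have this form with \<open>M\<close> the identity, and their inverses with \<open>L\<close> the identity and
  \<open>M\<close> the adjoint of a linear isometry.
\<close>
lemma C_on_linear_holomorphic_linear:
  fixes L :: "complex \<Rightarrow> 'b::real_normed_vector" and M :: "'a::euclidean_space \<Rightarrow> complex"
  assumes "bounded_linear L" "bounded_linear M" "h holomorphic_on V" "open V" "open U" "M ` U \<subseteq> V"
  shows "C_on k (\<lambda>x. L (h (M x))) U"
  using assms(1,3)
proof (induction k arbitrary: L h)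
  case 0
  have "continuous_on U (\<lambda>x. h (M x))"
    using 0(2) assms
    by (intro continuous_on_compose2[OF holomorphic_on_imp_continuous_on[OF 0(2)]]
        linear_continuous_on) auto
  then show ?case using bounded_linear.continuous_on[OF 0(1)] by simp
next
  case (Suc k)
  have D: "((\<lambda>x. L (h (M x))) has_derivative (\<lambda>v. L (deriv h (M x) * M v))) (at x)" if "x \<in> U" for x
    using has_derivative_linear_holomorphic_linear[OF Suc.prems(1) assms(2) Suc.prems(2)] assms(4,6) that
    by blast
  have "C_on k (\<lambda>x. frechet_derivative (\<lambda>x. L (h (M x))) (at x) b) U" for b
  proof (rule C_on_cong[OF \<open>open U\<close>])
    have "bounded_linear (\<lambda>c. L (c * M b))"
      using bounded_linear_compose[OF Suc.prems(1) bounded_linear_mult_left] .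
    moreover have "deriv h holomorphic_on V"
      using Suc.prems(2) assms(4) by (rule holomorphic_deriv)
    ultimately show "C_on k (\<lambda>x. L (deriv h (M x) * M b)) U" by (rule Suc.IH)
    show "L (deriv h (M x) * M b) = frechet_derivative (\<lambda>x. L (h (M x))) (at x) b" if "x \<in> U" for x
      using has_derivative_imp_frechet[OF D[OF that]] by simp
  qed
  moreover have "(\<lambda>x. L (h (M x))) differentiable (at x)" if "x \<in> U" for x
    using D[OF that] unfolding differentiable_def by blast
  ultimately show ?case by simp
qed

lemma smooth_on_linear_holomorphic_linear:
  fixes L :: "complex \<Rightarrow> 'b::real_normed_vector" and M :: "'a::euclidean_space \<Rightarrow> complex"
  assumes "bounded_linear L" "bounded_linear M" "h holomorphic_on V" "open V" "open U" "M ` U \<subseteq> V"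
    and "S \<subseteq> U" "\<And>x. x \<in> S \<Longrightarrow> f x = L (h (M x))"
  shows "smooth_on f S"
  unfolding smooth_on_def
  using C_on_linear_holomorphic_linear[OF assms(1-6)] assms(5,7,8)
  by (intro ballI exI[of _ U] exI[of _ "\<lambda>x. L (h (M x))"]) auto

lemma inner_complex: "x \<bullet> y = Re x * Re y + Im x * Im y" for x y :: complex
  by (simp add: inner_complex_def)

text \<open>
  Contraction bounds the squared lengths of the images of \<open>1\<close> and \<open>\<i>\<close> by \<open>1\<close>, so both equal \<open>1\<close>; the
  contraction property at \<open>1 + \<i>\<close> and \<open>1 - \<i>\<close> shows that their inner product is neither positive nor
  negative.
\<close>
lemma contraction_with_extremal_frame_imp_isometry:
  fixes L :: "complex \<Rightarrow> 'b::real_inner"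
  assumes L: "linear L" and contr: "\<And>w. cmod w < 1 \<Longrightarrow> norm (L w) \<le> 1"
    and extremal: "(norm (L 1))\<^sup>2 + (norm (L \<i>))\<^sup>2 = 2"
  shows "L u \<bullet> L v = u \<bullet> v"
proof -
  have le: "norm (L w) \<le> cmod w" for w
  proof (rule field_le_mult_one_interval)
    fix t :: real assume t: "0 < t" "t < 1"
    show "t * norm (L w) \<le> cmod w"
    proof (cases "w = 0")
      case True
      then show ?thesis using linear_0[OF L] by simp
    next
      case False
      have "cmod ((t / cmod w) *\<^sub>R w) < 1" using t False by simp
      from contr[OF this] have "t / cmod w * norm (L w) \<le> 1"
        using t False by (simp add: linear_scale[OF L])
      then show ?thesis using False by (simp add: field_simps)
    qed
  qed
  have le2: "L w \<bullet> L w \<le> (cmod w)\<^sup>2" for w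
    using le[of w] by (simp add: power2_norm_eq_inner[symmetric] power_mono)
  have s: "L 1 \<bullet> L 1 + L \<i> \<bullet> L \<i> = 2" using extremal by (simp add: power2_norm_eq_inner)
  have diag: "L 1 \<bullet> L 1 = 1" "L \<i> \<bullet> L \<i> = 1" using le2[of 1] le2[of \<i>] s by auto
  have "L (1 + \<i>) \<bullet> L (1 + \<i>) \<le> 2" "L (1 - \<i>) \<bullet> L (1 - \<i>) \<le> 2"
    using le2[of "1 + \<i>"] le2[of "1 - \<i>"] by (simp_all add: cmod_power2)
  then have off: "L 1 \<bullet> L \<i> = 0"
    using diag by (simp add: linear_add[OF L] linear_diff[OF L] inner_add_left inner_add_right
        inner_diff_left inner_diff_right inner_commute)
  have expand: "L w = Re w *\<^sub>R L 1 + Im w *\<^sub>R L \<i>" for w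
  proof -
    have "w = Re w *\<^sub>R 1 + Im w *\<^sub>R \<i>" by (simp add: complex_eq_iff)
    then have "L w = L (Re w *\<^sub>R 1 + Im w *\<^sub>R \<i>)" by simp
    also have "\<dots> = Re w *\<^sub>R L 1 + Im w *\<^sub>R L \<i>" by (simp only: linear_add[OF L] linear_scale[OF L])
    finally show ?thesis .
  qed
  show ?thesis
    unfolding expand[of u] expand[of v]
    using diag off by (simp add: inner_add_left inner_add_right inner_commute inner_complex)
qed

lemma linear_isometry_adjoint:
  fixes L :: "complex \<Rightarrow> 'b::euclidean_space"
  assumes L: "linear L" and iso: "\<And>u v. L u \<bullet> L v = u \<bullet> v"
  shows "linear (adjoint L)" "adjoint L (L w) = w" "norm (L w) = cmod w" "norm (adjoint L y) \<le> norm y"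
proof -
  show "linear (adjoint L)" using L by (rule adjoint_linear)
  show "adjoint L (L w) = w" for w
  proof (rule vector_eq_ldot[THEN iffD1], rule allI)
    show "x \<bullet> adjoint L (L w) = x \<bullet> w" for x by (simp add: adjoint_works[OF L] iso)
  qed
  show norm: "norm (L w) = cmod w" for w by (simp add: norm_eq_sqrt_inner iso)
  have "(norm (adjoint L y))\<^sup>2 = L (adjoint L y) \<bullet> y"
    by (simp add: power2_norm_eq_inner adjoint_works[OF L])
  also have "\<dots> \<le> norm (adjoint L y) * norm y" using norm_cauchy_schwarz[of "L (adjoint L y)" y] norm by simp
  finally show "norm (adjoint L y) \<le> norm y"
    by (cases "norm (adjoint L y) = 0") (simp_all add: power2_eq_square)
qed

section \<open>Planar conformal harmonic maps\<close>

text \<open>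
  The hypotheses on \<open>A\<close> and \<open>B\<close> say that \<open>h\<close> is harmonic.  Conformality at a point implies
  \<open>A'\<^sup>2 + B'\<^sup>2 = 0\<close>, that is \<open>(A' + \<i> B') (A' - \<i> B') = 0\<close>, where \<open>A' - \<i> B' = 0\<close> is the
  Cauchy-Riemann condition for \<open>h\<close> and \<open>A' + \<i> B' = 0\<close> the anti-holomorphic one.  At \<open>z\<close> the first factor
  does not vanish, hence not near \<open>z\<close>; so the second factor vanishes near \<open>z\<close> and, by the identity
  theorem, everywhere.
\<close>
lemma conformal_harmonic_imp_holomorphic:
  assumes S: "open S" "connected S" "z \<in> S"
    and AB: "A holomorphic_on S" "B holomorphic_on S"
    and h: "\<And>w. w \<in> S \<Longrightarrow> Re (h w) = Re (A w)" "\<And>w. w \<in> S \<Longrightarrow> Im (h w) = Re (B w)"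
    and conf: "conformal_on h S"
    and hz: "h field_differentiable (at z)"
  shows "h holomorphic_on S"
proof -
  have dh: "(h has_derivative (\<lambda>v. Complex (Re (deriv A w * v)) (Re (deriv B w * v)))) (at w)" if w: "w \<in> S" for w
  proof -
    have "((\<lambda>w. of_real (Re (A w)) + \<i> * of_real (Re (B w))) has_derivative
        (\<lambda>v. of_real (Re (deriv A w * v)) + \<i> * of_real (Re (deriv B w * v)))) (at w)"
      using holomorphic_derivI[OF AB(1) S(1) w] holomorphic_derivI[OF AB(2) S(1) w]
      by (intro derivative_intros) (simp_all add: has_field_derivative_def)
    then have "(h has_derivative
        (\<lambda>v. of_real (Re (deriv A w * v)) + \<i> * of_real (Re (deriv B w * v)))) (at w)"
      by (rule has_derivative_transform_within_open[OF _ S(1) w]) (simp add: h complex_eq_iff)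
    then show ?thesis unfolding Complex_eq .
  qed
  have prod0: "(deriv A w + \<i> * deriv B w) * (deriv A w - \<i> * deriv B w) = 0" if w: "w \<in> S" for w
  proof -
    define D where "D v = Complex (Re (deriv A w * v)) (Re (deriv B w * v))" for v
    have "frechet_derivative h (at w) = D"
      using has_derivative_imp_frechet[OF dh[OF w]] by (simp add: D_def[abs_def])
    then obtain c where "\<And>u v. D u \<bullet> D v = c * (u \<bullet> v)"
      using bspec[OF conf[unfolded conformal_on_def] w] by metis
    \<comment> \<open>the columns of the differential have equal length and are orthogonal: real and imaginary part of \<open>A'\<^sup>2 + B'\<^sup>2 = 0\<close>\<close>
    from this[of 1 1] this[of \<i> \<i>] this[of 1 \<i>] show ?thesis
      by (simp add: D_def inner_complex complex_eq_iff algebra_simps)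
  qed
  obtain d where d: "(h has_field_derivative d) (at z)" using hz field_differentiable_def by blast
  \<comment> \<open>Cauchy-Riemann at \<open>z\<close>, read off from the images of \<open>1\<close> and \<open>\<i>\<close>\<close>
  have CR: "deriv A z = d" "deriv B z = - \<i> * d"
  proof -
    have "Complex (Re (deriv A z * v)) (Re (deriv B z * v)) = d * v" for v
      using has_derivative_unique[OF dh[OF S(3)] d[unfolded has_field_derivative_def]] by metis
    from this[of 1] this[of \<i>] show "deriv A z = d" "deriv B z = - \<i> * d"
      by (auto simp: complex_eq_iff)
  qed
  have "d \<noteq> 0"
  proof
    assume "d = 0"
    then have dh0: "frechet_derivative h (at z) = (\<lambda>v. 0)"
      using has_derivative_imp_frechet[OF d[unfolded has_field_derivative_def]] by (simp add: fun_eq_iff)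
    obtain c :: real where "c > 0" "\<And>u v :: complex. (0 :: complex) \<bullet> 0 = c * (u \<bullet> v)"
      using bspec[OF conf[unfolded conformal_on_def] S(3)] unfolding dh0 by blast
    from this(1) this(2)[of 1 1] show False by simp
  qed
  define p where "p w = deriv A w + \<i> * deriv B w" for w
  define q where "q w = deriv A w - \<i> * deriv B w" for w
  have pq: "p holomorphic_on S" "q holomorphic_on S"
    unfolding p_def[abs_def] q_def[abs_def]
    by (intro holomorphic_intros holomorphic_deriv AB S)+
  have "p z = 2 * d" by (simp add: p_def CR)
  then have pz: "p z \<noteq> 0" using \<open>d \<noteq> 0\<close> by simp
  have op: "open (S \<inter> p -` (- {0}))"
    using holomorphic_on_imp_continuous_on[OF pq(1)] S(1) by (intro continuous_open_preimage) auto
  have q0: "q w = 0" if "w \<in> S" for w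
  proof (rule analytic_continuation_open[OF op S(1) _ S(2) _ pq(2) holomorphic_on_const _ that])
    show "S \<inter> p -` (- {0}) \<noteq> {}" using S(3) pz by auto
    show "q w = 0" if "w \<in> S \<inter> p -` (- {0})" for w
      using prod0[of w] that by (auto simp: p_def q_def)
  qed auto
  have "(h has_field_derivative deriv A w) (at w)" if w: "w \<in> S" for w
  proof -
    have "deriv B w = - \<i> * deriv A w" using q0[OF w] by (auto simp: q_def complex_eq_iff)
    then have "Complex (Re (deriv A w * v)) (Re (deriv B w * v)) = deriv A w * v" for v
      by (simp add: complex_eq_iff)
    then show ?thesis using dh[OF w] by (simp add: has_field_derivative_def)
  qed
  then show ?thesis using holomorphic_on_open[OF S(1)] by blast
qed

text \<open>
  The Schwarz lemma for \<open>\<psi> \<circ> g\<close>, where \<open>g\<close> is the inverse of \<open>h\<close> and the Moebius map \<open>\<psi>\<close> sends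
  \<open>z = g 0\<close> back to \<open>0\<close>, bounds the derivative of \<open>g\<close> from above, hence that of \<open>h\<close> from below.
\<close>
lemma schwarz_pick_lower_bound_of_biholomorphism:
  assumes h: "h holomorphic_on ball 0 1" "bij_betw h (ball 0 1) (ball 0 1)"
    and z: "z \<in> ball 0 1" "h z = 0"
  shows "1 \<le> (1 - (cmod z)\<^sup>2) * cmod (deriv h z)"
proof -
  have inj: "inj_on h (ball 0 1)" and im: "h ` ball 0 1 = ball 0 1"
    using h(2) by (auto simp: bij_betw_def)
  obtain g where g: "g holomorphic_on ball 0 1"
    "\<And>z. z \<in> ball 0 1 \<Longrightarrow> deriv h z * deriv g (h z) = 1" "\<And>z. z \<in> ball 0 1 \<Longrightarrow> g (h z) = z"
    using holomorphic_has_inverse[OF h(1) open_ball inj] unfolding im by metis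
  define \<psi> where "\<psi> = Moebius_function 0 z"
  define s where "s = 1 - (cmod z)\<^sup>2"
  have s: "s > 0" using one_minus_power2_cmod_pos z by (simp add: s_def)
  have \<psi>: "\<psi> holomorphic_on ball 0 1" "\<psi> ` ball 0 1 \<subseteq> ball 0 1" "\<psi> z = 0" "deriv \<psi> z = of_real (1 / s)"
    using z Moebius_function_holomorphic[of z 0] Moebius_function_norm_lt_1[of z]
      deriv_Moebius_function(2)[of z]
    by (auto simp: \<psi>_def s_def Moebius_function_eq_zero)
  have g_im: "g ` ball 0 1 \<subseteq> ball 0 1"
  proof (rule image_subsetI)
    fix y :: complex assume "y \<in> ball 0 1"
    then obtain x where "x \<in> ball 0 1" "y = h x" using im by blast
    then show "g y \<in> ball 0 1" using g(3) by simp
  qed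
  have g0: "g 0 = z" using g(3)[OF z(1)] z(2) by simp
  have "cmod (deriv (\<psi> \<circ> g) 0) \<le> 1"
  proof (rule Schwarz_Lemma(2))
    show "\<psi> \<circ> g holomorphic_on ball 0 1" by (rule holomorphic_on_compose_gen[OF g(1) \<psi>(1) g_im])
    show "(\<psi> \<circ> g) 0 = 0" by (simp add: g0 \<psi>)
    show "cmod ((\<psi> \<circ> g) w) < 1" if "cmod w < 1" for w
      using \<psi>(2) g_im that by (simp add: image_subset_iff)
    show "cmod 0 < 1" by simp
  qed
  moreover have "deriv (\<psi> \<circ> g) 0 = deriv \<psi> (g 0) * deriv g 0"
    using holomorphic_on_imp_differentiable_at[OF g(1) open_ball, of 0]
      holomorphic_on_imp_differentiable_at[OF \<psi>(1) open_ball z(1)]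
    by (intro deriv_chain) (simp_all add: g0)
  ultimately have "cmod (deriv g 0) \<le> s"
    using s by (simp add: g0 \<psi> norm_mult norm_divide divide_simps)
  moreover have "cmod (deriv h z) * cmod (deriv g 0) = 1"
    using g(2)[OF z(1)] by (simp add: z(2) norm_mult[symmetric])
  ultimately have "1 \<le> cmod (deriv h z) * s"
    by (metis mult_left_mono norm_ge_zero)
  then show ?thesis by (simp add: s_def mult.commute)
qed

section \<open>The equality cases\<close>

lemma range_scaleR_linear:
  assumes "linear T" "s \<noteq> 0"
  shows "range (\<lambda>w. s *\<^sub>R T w) = range T"
proof (intro subset_antisym image_subsetI)
  show "s *\<^sub>R T w \<in> range T" for w
    using rangeI[of T "s *\<^sub>R w"] by (simp add: linear_scale[OF assms(1)])
  show "T w \<in> range (\<lambda>w. s *\<^sub>R T w)" for w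
    using rangeI[of "\<lambda>w. s *\<^sub>R T w" "w /\<^sub>R s"] assms(2) by (simp add: linear_scale[OF assms(1)])
qed

text \<open>
  Orthogonality makes \<open>f z\<close> the centre of the affine disc, of radius \<open>\<rho>\<close>.  In the coordinate \<open>h\<close> for
  which \<open>f = f z + \<rho> E(h)\<close>, with \<open>E\<close> a linear isometry onto \<open>df\<^sub>z(\<real>\<^sup>2)\<close>, the map becomes a conformal
  harmonic bijection of the unit disc.
\<close>
lemma conformal_diffeomorphism_onto_centred_disc_grad:
  fixes f :: "complex \<Rightarrow> real ^ 'n"
  assumes f: "harmonic_map_on f (ball 0 1)" "f ` ball 0 1 \<subseteq> ball 0 1" and z: "z \<in> ball 0 1"
    and orth: "\<And>v. v \<in> tangent_image f z \<Longrightarrow> orthogonal (f z) v"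
    and diffeo: "conformal_diffeomorphism_onto f (ball 0 1) ((\<lambda>v. f z + v) ` tangent_image f z \<inter> ball 0 1)"
  shows "1 \<le> (norm (f z))\<^sup>2 + ((1 - (cmod z)\<^sup>2) * norm_grad f z)\<^sup>2 / 2"
proof -
  define D where "D w = frechet_derivative f (at w)" for w
  define \<rho> where "\<rho> = sqrt (1 - (norm (f z))\<^sup>2)"
  have fz: "norm (f z) < 1" using f(2) z by (simp add: image_subset_iff)
  then have "(norm (f z))\<^sup>2 < 1" by (simp add: power_less_one_iff abs_square_less_1)
  then have \<rho>: "\<rho> > 0" "\<rho>\<^sup>2 = 1 - (norm (f z))\<^sup>2" by (simp_all add: \<rho>_def)
  have bij: "bij_betw f (ball 0 1) ((\<lambda>v. f z + v) ` tangent_image f z \<inter> ball 0 1)"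
    and conf: "conformal_on f (ball 0 1)"
    using diffeo by (auto simp: conformal_diffeomorphism_onto_def diffeomorphism_onto_def)
  have df: "(f has_derivative D w) (at w)" if "w \<in> ball 0 1" for w
    using conf that has_derivative_frechet unfolding conformal_on_def D_def by blast
  have confD: "\<exists>c>0. \<forall>u v. D w u \<bullet> D w v = c * (u \<bullet> v)" if "w \<in> ball 0 1" for w
    using conf that unfolding conformal_on_def D_def by blast
  obtain c where c: "c > 0" "\<And>u v. D z u \<bullet> D z v = c * (u \<bullet> v)" using confD[OF z] by blast
  \<comment> \<open>normalising \<open>df\<^sub>z\<close> itself makes \<open>dh\<^sub>z\<close> a positive multiple of the identity, which fixes the orientation\<close>
  define E where "E u = D z u /\<^sub>R sqrt c" for u
  have linE: "linear E"
    unfolding E_def[abs_def] using has_derivative_linear[OF df[OF z]] by (intro linear_compose_scale_right)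
  have isoE: "E u \<bullet> E v = u \<bullet> v" for u v
    using c by (simp add: E_def divide_simps)
  note adj = linear_isometry_adjoint[OF linE isoE]
  have rangeE: "range E = tangent_image f z"
    unfolding E_def[abs_def] tangent_image_def D_def[symmetric]
    using has_derivative_linear[OF df[OF z]] c(1) by (intro range_scaleR_linear) auto
  define M where "M = adjoint E"
  have blM: "bounded_linear M" and blE: "bounded_linear E"
    using adj(1) linE by (simp_all add: M_def linear_conv_bounded_linear)
  define h where "h w = M (f w - f z) /\<^sub>R \<rho>" for w
  have f_eq: "f w = f z + \<rho> *\<^sub>R E (h w)" if "w \<in> ball 0 1" for w
  proof -
    have "f w \<in> (\<lambda>v. f z + v) ` range E" using bij_betw_imp_surj_on[OF bij] that rangeE by blast
    then obtain u where "f w = f z + E u" by blast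
    then show ?thesis using \<rho> by (simp add: h_def M_def adj linear_scale[OF linE])
  qed
  have norm_f: "(norm (f z + \<rho> *\<^sub>R E u))\<^sup>2 = (norm (f z))\<^sup>2 + \<rho>\<^sup>2 * (cmod u)\<^sup>2" for u
  proof -
    have "E u \<in> tangent_image f z" unfolding rangeE[symmetric] by (rule rangeI)
    then have "orthogonal (f z) (\<rho> *\<^sub>R E u)"
      using orth[of "E u"] by (simp add: orthogonal_def)
    from norm_add_Pythagorean[OF this] show ?thesis
      by (simp add: adj(3) power_mult_distrib)
  qed
  have in_ball: "f z + \<rho> *\<^sub>R E u \<in> ball 0 1 \<longleftrightarrow> u \<in> ball 0 1" for u
  proof -
    have "f z + \<rho> *\<^sub>R E u \<in> ball 0 1 \<longleftrightarrow> (norm (f z + \<rho> *\<^sub>R E u))\<^sup>2 < 1"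
      by (simp add: power_less_one_iff abs_square_less_1)
    also have "\<dots> \<longleftrightarrow> \<rho>\<^sup>2 * (cmod u)\<^sup>2 < \<rho>\<^sup>2 * 1" unfolding norm_f \<rho>(2) by auto
    also have "\<dots> \<longleftrightarrow> (cmod u)\<^sup>2 < 1" using \<rho>(1) by (subst mult_less_cancel_left_pos) auto
    also have "\<dots> \<longleftrightarrow> u \<in> ball 0 1" by (simp add: power_less_one_iff abs_square_less_1)
    finally show ?thesis .
  qed
  have bijh: "bij_betw h (ball 0 1) (ball 0 1)"
  proof (rule bij_betwI')
    show "h x = h y \<longleftrightarrow> x = y" if "x \<in> ball 0 1" "y \<in> ball 0 1" for x y
      using that f_eq bij_betw_imp_inj_on[OF bij] by (metis inj_onD)
    show "h x \<in> ball 0 1" if "x \<in> ball 0 1" for x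
    proof -
      have "f x \<in> ball 0 1" using f(2) that by blast
      then show ?thesis unfolding f_eq[OF that] in_ball .
    qed
    show "\<exists>x\<in>ball 0 1. y = h x" if "y \<in> ball 0 1" for y
    proof -
      have "\<rho> *\<^sub>R E y \<in> tangent_image f z"
        unfolding rangeE[symmetric] linear_scale[OF linE, symmetric] by blast
      then have "f z + \<rho> *\<^sub>R E y \<in> f ` ball 0 1"
        using in_ball that bij_betw_imp_surj_on[OF bij] by blast
      then obtain x where x: "x \<in> ball 0 1" "f x = f z + \<rho> *\<^sub>R E y" by force
      then have "h x = y" using \<rho> by (simp add: h_def M_def linear_scale[OF adj(1)] adj)
      with x show ?thesis by blast
    qed
  qed
  have dh: "(h has_derivative (\<lambda>v. M (D w v) /\<^sub>R \<rho>)) (at w)" if w: "w \<in> ball 0 1" for w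
  proof -
    have "((\<lambda>w. M (f w - f z)) has_derivative (\<lambda>v. M (D w v))) (at w)"
      using df[OF w] by (intro bounded_linear.has_derivative[OF blM]) (auto intro!: derivative_eq_intros)
    then show ?thesis unfolding h_def[abs_def] by (intro derivative_intros)
  qed
  \<comment> \<open>\<open>f\<close> stays in a translate of the range of \<open>E\<close>, so its differential takes values in that range,
    where \<open>M\<close> is isometric\<close>
  have D_eq: "D w v = \<rho> *\<^sub>R E (M (D w v) /\<^sub>R \<rho>)" if w: "w \<in> ball 0 1" for w v
  proof -
    have "((\<lambda>w. f z + \<rho> *\<^sub>R E (h w)) has_derivative (\<lambda>v. \<rho> *\<^sub>R E (M (D w v) /\<^sub>R \<rho>))) (at w)"
      using bounded_linear.has_derivative[OF blE dh[OF w]] by (auto intro!: derivative_eq_intros)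
    then have "(f has_derivative (\<lambda>v. \<rho> *\<^sub>R E (M (D w v) /\<^sub>R \<rho>))) (at w)"
      by (rule has_derivative_transform_within_open[OF _ open_ball w]) (simp add: f_eq[symmetric])
    from has_derivative_unique[OF df[OF w] this] show ?thesis by metis
  qed
  have confh: "conformal_on h (ball 0 1)"
    unfolding conformal_on_def
  proof (intro ballI conjI)
    fix w :: complex assume w: "w \<in> ball 0 1"
    show "h differentiable (at w)" using dh[OF w] unfolding differentiable_def by blast
    obtain b where b: "b > 0" "\<And>u v. D w u \<bullet> D w v = b * (u \<bullet> v)" using confD[OF w] by blast
    have "(M (D w u) /\<^sub>R \<rho>) \<bullet> (M (D w v) /\<^sub>R \<rho>) = (b / \<rho>\<^sup>2) * (u \<bullet> v)" for u v
    proof -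
      have "\<rho>\<^sup>2 * ((M (D w u) /\<^sub>R \<rho>) \<bullet> (M (D w v) /\<^sub>R \<rho>))
          = (\<rho> *\<^sub>R E (M (D w u) /\<^sub>R \<rho>)) \<bullet> (\<rho> *\<^sub>R E (M (D w v) /\<^sub>R \<rho>))"
        unfolding inner_scaleR_left inner_scaleR_right isoE by (simp add: power2_eq_square)
      also have "\<dots> = b * (u \<bullet> v)" unfolding D_eq[OF w, symmetric] by (rule b(2))
      finally show ?thesis using \<rho>(1) by (simp add: field_simps)
    qed
    then show "\<exists>c>0. \<forall>u v. frechet_derivative h (at w) u \<bullet> frechet_derivative h (at w) v = c * (u \<bullet> v)"
      unfolding has_derivative_imp_frechet[OF dh[OF w]] using b(1) \<rho>(1)
      by (intro exI[of _ "b / \<rho>\<^sup>2"]) simp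
  qed
  have hz: "(h has_field_derivative of_real (sqrt c / \<rho>)) (at z)"
  proof -
    have "M (D z v) /\<^sub>R \<rho> = of_real (sqrt c / \<rho>) * v" for v
    proof -
      have "D z v = sqrt c *\<^sub>R E v" using c(1) by (simp add: E_def)
      then have "M (D z v) = sqrt c *\<^sub>R v" by (simp add: M_def linear_scale[OF adj(1)] adj)
      then show ?thesis by (simp add: scaleR_conv_of_real field_simps)
    qed
    then have "(\<lambda>v. M (D z v) /\<^sub>R \<rho>) = (*) (of_real (sqrt c / \<rho>))" by (rule ext)
    then show ?thesis using dh[OF z] by (simp only: has_field_derivative_def)
  qed
  obtain G where G: "\<And>k. G k holomorphic_on ball 0 1" "\<And>z k. z \<in> ball 0 1 \<Longrightarrow> f z $ k = Re (G k z)"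
    using harmonic_map_on_imp_Re_holomorphic[OF f(1) convex_ball] by blast
  have component: "\<exists>A. A holomorphic_on ball 0 1 \<and> (\<forall>w\<in>ball 0 1. e \<bullet> h w = Re (A w))" for e
  proof (intro exI conjI ballI)
    let ?A = "\<lambda>w. \<Sum>k\<in>UNIV. of_real (E e $ k / \<rho>) * (G k w - of_real (f z $ k))"
    show "?A holomorphic_on ball 0 1" by (intro holomorphic_intros G)
    show "e \<bullet> h w = Re (?A w)" if "w \<in> ball 0 1" for w
    proof -
      have "e \<bullet> h w = (E e \<bullet> (f w - f z)) / \<rho>"
        by (simp add: h_def M_def adjoint_works[OF linE] divide_inverse mult.commute)
      also have "\<dots> = Re (?A w)"
        using G(2)[OF that] by (simp add: inner_vec_def sum_divide_distrib)
      finally show ?thesis .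
    qed
  qed
  obtain A B where "A holomorphic_on ball 0 1" "B holomorphic_on ball 0 1"
    "\<And>w. w \<in> ball 0 1 \<Longrightarrow> Re (h w) = Re (A w)" "\<And>w. w \<in> ball 0 1 \<Longrightarrow> Im (h w) = Re (B w)"
    using component[of 1] component[of \<i>] by (auto simp: inner_complex)
  from conformal_harmonic_imp_holomorphic[OF open_ball connected_ball z this confh]
  have "h holomorphic_on ball 0 1" using hz field_differentiable_def by blast
  from schwarz_pick_lower_bound_of_biholomorphism[OF this bijh z]
  have "1 \<le> (1 - (cmod z)\<^sup>2) * (sqrt c / \<rho>)"
    using DERIV_imp_deriv[OF hz] c(1) \<rho>(1) linear_0[OF adj(1)] by (simp add: h_def M_def norm_divide)
  then have "\<rho> \<le> (1 - (cmod z)\<^sup>2) * sqrt c" using \<rho>(1) by (simp add: field_simps)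
  then have "\<rho>\<^sup>2 \<le> ((1 - (cmod z)\<^sup>2) * sqrt c)\<^sup>2" using \<rho>(1) by (intro power_mono) auto
  moreover have "(norm_grad f z)\<^sup>2 = 2 * c"
    unfolding power2_norm_grad D_def[symmetric] by (simp add: power2_norm_eq_inner c(2))
  ultimately show ?thesis using c(1) \<rho>(2) by (simp add: power_mult_distrib)
qed

text \<open>
  Equality makes \<open>f \<circ> \<phi>\<close> equal to the linear map \<open>L\<close>, which is an isometry; so \<open>f = L \<circ> \<psi>\<close> with \<open>\<psi>\<close> the
  inverse of \<open>\<phi>\<close>, and the inverse of \<open>f\<close> is the restriction of \<open>\<phi> \<circ> M\<close>, where the adjoint \<open>M\<close> of \<open>L\<close>
  is defined and contracting on all of the target space.
\<close>
lemma extremal_harmonic_map_is_conformal_diffeomorphism: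
  fixes f :: "complex \<Rightarrow> real ^ 'n"
  assumes f: "harmonic_map_on f (ball 0 1)" "f ` ball 0 1 \<subseteq> ball 0 1" and z: "z \<in> ball 0 1"
    and fz: "f z = 0" and eq: "((1 - (cmod z)\<^sup>2) * norm_grad f z)\<^sup>2 = 2"
  shows "dim (tangent_image f z) = 2"
    and "conformal_diffeomorphism_onto f (ball 0 1) (tangent_image f z \<inter> ball 0 1)"
proof -
  define s where "s = 1 - (cmod z)\<^sup>2"
  have s: "s > 0" using one_minus_power2_cmod_pos z by (simp add: s_def)
  define L where "L w = s *\<^sub>R frechet_derivative f (at z) w" for w
  define \<phi> where "\<phi> = Moebius_function 0 (- z)"
  define \<psi> where "\<psi> = Moebius_function 0 z"
  have \<phi>: "\<phi> holomorphic_on ball 0 1" "\<And>w. w \<in> ball 0 1 \<Longrightarrow> \<phi> w \<in> ball 0 1"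
    and \<psi>: "\<psi> holomorphic_on ball 0 1" "\<And>w. w \<in> ball 0 1 \<Longrightarrow> \<psi> w \<in> ball 0 1"
    using z Moebius_function_holomorphic[of z 0] Moebius_function_norm_lt_1[of z]
      Moebius_function_holomorphic[of "- z" 0] Moebius_function_norm_lt_1[of "- z"]
    by (auto simp: \<phi>_def \<psi>_def)
  have \<phi>\<psi>: "\<phi> (\<psi> w) = w" and \<psi>\<phi>: "\<psi> (\<phi> w) = w" if "w \<in> ball 0 1" for w
    using z that by (auto simp: \<phi>_def \<psi>_def intro!: Moebius_function_compose)
  obtain G where G: "\<And>k. G k holomorphic_on ball 0 1" "\<And>z k. z \<in> ball 0 1 \<Longrightarrow> f z $ k = Re (G k z)"
    using harmonic_map_on_imp_Re_holomorphic[OF f(1) convex_ball] by blast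
  have "f differentiable (at z)"
    using has_derivative_Re_holomorphic_components[OF open_ball G z] unfolding differentiable_def by blast
  then have linL: "linear L"
    unfolding L_def[abs_def] by (intro linear_compose_scale_right linear_frechet_derivative)
  have fL: "f (\<phi> w) = L w" if "w \<in> ball 0 1" for w
    using harmonic_schwarz_pick(2)[OF f z _ that] eq by (simp add: fz \<phi>_def L_def s_def)
  have f\<psi>: "f w = L (\<psi> w)" if "w \<in> ball 0 1" for w
    using fL[OF \<psi>(2)[OF that]] \<phi>\<psi>[OF that] by simp
  have iso: "L u \<bullet> L v = u \<bullet> v" for u v
  proof (rule contraction_with_extremal_frame_imp_isometry[OF linL])
    show "norm (L w) \<le> 1" if "cmod w < 1" for w
    proof -
      have "f (\<phi> w) \<in> ball 0 1" using f(2) \<phi>(2)[of w] that by (simp add: image_subset_iff)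
      then show ?thesis using fL[of w] that by simp
    qed
    show "(norm (L 1))\<^sup>2 + (norm (L \<i>))\<^sup>2 = 2"
      using eq s by (simp add: L_def power_mult_distrib power2_norm_grad s_def[symmetric] distrib_left)
  qed
  note adj = linear_isometry_adjoint[OF linL iso]
  define M where "M = adjoint L"
  have bl: "bounded_linear M" "bounded_linear L" "bounded_linear (\<lambda>x::complex. x)"
    using adj(1) linL by (auto simp: M_def linear_conv_bounded_linear[symmetric] linear_ident)
  have rangeL: "range L = tangent_image f z"
    unfolding L_def[abs_def] tangent_image_def
    using \<open>f differentiable (at z)\<close> s by (intro range_scaleR_linear linear_frechet_derivative) auto
  have injL: "inj L" using adj(2) by (rule inj_on_inverseI)
  then show "dim (tangent_image f z) = 2"
    unfolding rangeL[symmetric] using dim_image_eq[OF linL, of UNIV] by (simp only: span_UNIV dim_UNIV DIM_complex)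
  have M_ball: "M y \<in> ball 0 1" if "y \<in> ball 0 1" for y
    using adj(4)[of y] that by (simp add: M_def)
  have bij: "bij_betw f (ball 0 1) (tangent_image f z \<inter> ball 0 1)"
  proof (rule bij_betwI[where g = "\<lambda>y. \<phi> (M y)"])
    show "f \<in> ball 0 1 \<rightarrow> tangent_image f z \<inter> ball 0 1"
    proof (intro Pi_I IntI)
      show "f w \<in> tangent_image f z" if "w \<in> ball 0 1" for w
        unfolding rangeL[symmetric] f\<psi>[OF that] by (rule rangeI)
      show "f w \<in> ball 0 1" if "w \<in> ball 0 1" for w using f(2) that by blast
    qed
    show "(\<lambda>y. \<phi> (M y)) \<in> tangent_image f z \<inter> ball 0 1 \<rightarrow> ball 0 1"
      using \<phi>(2) M_ball by blast
    show "\<phi> (M (f x)) = x" if "x \<in> ball 0 1" for x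
      using that by (simp add: f\<psi> M_def adj \<phi>\<psi>)
    show "f (\<phi> (M y)) = y" if "y \<in> tangent_image f z \<inter> ball 0 1" for y
    proof -
      obtain w where "y = L w" using \<open>y \<in> _\<close> rangeL by blast
      then show ?thesis using fL[of "M y"] M_ball[of y] that by (simp add: M_def adj)
    qed
  qed
  have inverse: "inv_into (ball 0 1) f y = \<phi> (M y)" if y: "y \<in> tangent_image f z \<inter> ball 0 1" for y
  proof (rule inv_into_f_eq)
    show "inj_on f (ball 0 1)" using bij by (rule bij_betw_imp_inj_on)
    obtain w where w: "y = L w" using y rangeL by blast
    then have "w \<in> ball 0 1" using y by (simp add: adj)
    moreover have "M y = w" using w by (simp add: M_def adj)
    ultimately show "\<phi> (M y) \<in> ball 0 1" "f (\<phi> (M y)) = y" by (simp_all only: \<phi>(2) fL w)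
  qed
  have "smooth_on f (ball 0 1)"
    by (rule smooth_on_linear_holomorphic_linear[where U = "ball 0 1" and V = "ball 0 1", OF bl(2,3) \<psi>(1) open_ball open_ball]) (simp_all only: f\<psi> subset_refl image_ident)
  moreover have "smooth_on (inv_into (ball 0 1) f) (tangent_image f z \<inter> ball 0 1)"
    by (rule smooth_on_linear_holomorphic_linear[where U = "ball 0 1" and V = "ball 0 1", OF bl(3,1) \<phi>(1) open_ball open_ball image_subsetI])
      (simp_all only: M_ball inverse Int_lower2)
  moreover have "conformal_on f (ball 0 1)"
    unfolding conformal_on_def
  proof (intro ballI conjI)
    fix w :: complex assume w: "w \<in> ball 0 1"
    have "((\<lambda>w. L (\<psi> w)) has_derivative (\<lambda>v. L (deriv \<psi> w * v))) (at w)"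
      using has_derivative_linear_holomorphic_linear[OF bl(2,3) \<psi>(1) open_ball w] .
    then have df: "(f has_derivative (\<lambda>v. L (deriv \<psi> w * v))) (at w)"
      by (rule has_derivative_transform_within_open[OF _ open_ball w]) (simp add: f\<psi>)
    then show "f differentiable (at w)" unfolding differentiable_def by blast
    have inj\<psi>: "inj_on \<psi> (ball 0 1)" using \<phi>\<psi> by (rule inj_on_inverseI)
    have "deriv \<psi> w \<noteq> 0" using holomorphic_injective_imp_regular[OF \<psi>(1) open_ball inj\<psi> w] .
    moreover have "L (deriv \<psi> w * u) \<bullet> L (deriv \<psi> w * v) = (cmod (deriv \<psi> w))\<^sup>2 * (u \<bullet> v)" for u v
      unfolding iso inner_complex cmod_power2 by (simp add: algebra_simps power2_eq_square)
    ultimately show "\<exists>c>0. \<forall>u v. frechet_derivative f (at w) u \<bullet> frechet_derivative f (at w) v = c * (u \<bullet> v)"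
      unfolding has_derivative_imp_frechet[OF df] by (intro exI[of _ "(cmod (deriv \<psi> w))\<^sup>2"]) simp
  qed
  ultimately show "conformal_diffeomorphism_onto f (ball 0 1) (tangent_image f z \<inter> ball 0 1)"
    using bij by (simp add: conformal_diffeomorphism_onto_def diffeomorphism_onto_def)
qed

theorem theorem2p2:
  fixes f :: "complex \<Rightarrow> real ^ 'n" and z :: complex
  assumes "CARD('n) \<ge> 2"
    and "harmonic_map_on f (ball 0 1)"
    and "f ` ball 0 1 \<subseteq> ball 0 1"
    and "z \<in> ball 0 1"
  shows "(1 / sqrt 2) * norm_grad f z \<le> sqrt (1 - (norm (f z))\<^sup>2) / (1 - (cmod z)\<^sup>2) \<and>
    (dim (tangent_image f z) = 2 \<and>
       (\<forall>v \<in> tangent_image f z. orthogonal (f z) v) \<and>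
       conformal_diffeomorphism_onto f (ball 0 1)
         ((\<lambda>v. f z + v) ` tangent_image f z \<inter> ball 0 1) \<longrightarrow>
       (1 / sqrt 2) * norm_grad f z = sqrt (1 - (norm (f z))\<^sup>2) / (1 - (cmod z)\<^sup>2)) \<and>
    (f z = 0 \<longrightarrow>
       norm_grad f z \<le> sqrt 2 / (1 - (cmod z)\<^sup>2) \<and>
       (norm_grad f z = sqrt 2 / (1 - (cmod z)\<^sup>2) \<longleftrightarrow>
         dim (tangent_image f z) = 2 \<and>
         conformal_diffeomorphism_onto f (ball 0 1) (tangent_image f z \<inter> ball 0 1)))"
proof -
  note f = assms(2,3) and z = assms(4)
  define s where "s = 1 - (cmod z)\<^sup>2"
  define g where "g = norm_grad f z"
  define b where "b = 1 - (norm (f z))\<^sup>2"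
  have s: "s > 0" using one_minus_power2_cmod_pos z by (simp add: s_def)
  have g: "g \<ge> 0" by (simp add: g_def norm_grad_def)
  have main: "(s * g)\<^sup>2 / 2 \<le> b"
    using harmonic_schwarz_pick(1)[OF f z] by (simp add: s_def g_def b_def)
  have sg: "s * g / sqrt 2 = sqrt ((s * g)\<^sup>2 / 2)"
    using s g by (simp add: real_sqrt_divide)
  have le: "1 / sqrt 2 * g \<le> sqrt b / s"
  proof -
    have "s * g / sqrt 2 \<le> sqrt b" unfolding sg using main by simp
    then show ?thesis using s by (simp add: field_simps)
  qed
  have eq_iff: "1 / sqrt 2 * g = sqrt b / s \<longleftrightarrow> (s * g)\<^sup>2 / 2 = b"
  proof -
    have "1 / sqrt 2 * g = sqrt b / s \<longleftrightarrow> s * g / sqrt 2 = sqrt b" using s by (auto simp: field_simps)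
    then show ?thesis unfolding sg by simp
  qed
  have conv: "(s * g)\<^sup>2 / 2 = b"
    if "\<And>v. v \<in> tangent_image f z \<Longrightarrow> orthogonal (f z) v"
      "conformal_diffeomorphism_onto f (ball 0 1) ((\<lambda>v. f z + v) ` tangent_image f z \<inter> ball 0 1)"
    using conformal_diffeomorphism_onto_centred_disc_grad[OF f z that] main
    by (simp add: s_def g_def b_def)
  have scale: "g \<le> sqrt 2 / s \<longleftrightarrow> 1 / sqrt 2 * g \<le> sqrt 1 / s"
    "g = sqrt 2 / s \<longleftrightarrow> 1 / sqrt 2 * g = sqrt 1 / s"
    using s by (auto simp: field_simps)
  have centred: "g \<le> sqrt 2 / s \<and> (g = sqrt 2 / s \<longleftrightarrow> dim (tangent_image f z) = 2 \<and>
      conformal_diffeomorphism_onto f (ball 0 1) (tangent_image f z \<inter> ball 0 1))" if fz: "f z = 0"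
  proof -
    have b: "b = 1" by (simp add: b_def fz)
    have "(s * g)\<^sup>2 / 2 = 1" if "conformal_diffeomorphism_onto f (ball 0 1) (tangent_image f z \<inter> ball 0 1)"
      using conv that by (simp add: b fz orthogonal_clauses)
    moreover have "dim (tangent_image f z) = 2"
        "conformal_diffeomorphism_onto f (ball 0 1) (tangent_image f z \<inter> ball 0 1)" if "(s * g)\<^sup>2 / 2 = 1"
      using extremal_harmonic_map_is_conformal_diffeomorphism[OF f z fz] that by (simp_all add: s_def g_def)
    ultimately show ?thesis unfolding scale using le eq_iff unfolding b by blast
  qed
  show ?thesis
    unfolding s_def[symmetric] g_def[symmetric] b_def[symmetric]
    using le eq_iff conv centred by blast
qed

end
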